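(* Let $E$ be an arbitrary subset of $\mathbb{R}^n$, $N:E\to\mathbb{S}^{n-1}$ a continuous mapping, $X$ a linear subspace of $\mathbb{R}^n$, and $P:\mathbb{R}^n\to X$ the orthogonal projection. Then there exists a (possibly unbounded) convex body $W$ of class $C^1$ such that $E\subset\partial W$, $0\in\mathrm{int}(W)$, $N(x)=n_W(x)$ for all $x\in E$, and $X=\mathrm{span}(n_W(\partial W))$, if and only if the following conditions are satisfied: (1) $\langle N(y),x-y\rangle\leq 0$ for all $x,y\in E$. (2) For all sequences $(x_k)_k$, $(z_k)_k$ contained in $E$ with $(P(x_k))_k$ bounded, we have that $$\lim_{k\to\infty}\langle N(z_k),x_k-z_k\rangle=0\implies\lim_{k\to\infty}|N(z_k)-N(x_k)|=0.$$ (3) $0<\inf_{y\in E}\langle N(y),y\rangle$. (4) Denoting $d=\dim(X)$, $Y=\mathrm{span}(N(E))$, $\ell=\dim(Y)$, we have that $Y\subseteq X$, and if $Y\neq X$ and $P_Y:\mathbb{R}^n\to Y$ is the orthogonal projection, then there exist linearly independent vectors $w_1,\ldots,w_{d-\ell}\in X\cap Y^{\perp}$ with $|w_j|=1$ for each $j$, points $p_1,\ldots,p_{d-\ell}\in\mathbb{R}^n$, and a number $\varepsilon\in(0,1)$ such that $$\left(\overline{E}\cup\{0\}\right)\cap\left(\bigcup_{j=1}^{d-\ell}V_j\right)=\emptyset,$$ where $V_j:=\{x\in\mathbb{R}^n : \varepsilon\langle w_j,x-p_j\rangle\geq|P_Y(x-p_j)|\}$ for every $j=1,\ldots,d-\e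ll$.
   Context: $\langle\cdot,\cdot\rangle$ and $|\cdot|$ denote the Euclidean inner product and norm on $\mathbb{R}^n$, and $\mathbb{S}^{n-1}$ is the unit sphere. A (possibly unbounded) convex body is a closed convex subset $W$ of $\mathbb{R}^n$ with nonempty interior. If $0\in\mathrm{int}(W)$, the Minkowski functional of $W$ is $\mu_W(x)=\inf\{\lambda>0 : \tfrac1\lambda x\in W\}$, and $W$ is said to be of class $C^1$ if $\mu_W$ is of class $C^1$ on the open set $\mathbb{R}^n\setminus\mu_W^{-1}(0)$. In that case the outer normal to $\partial W$ is $n_W(x)=\nabla\mu_W(x)/|\nabla\mu_W(x)|$ for $x\in\partial W$. An infimum over the empty set is $+\infty$. *)

theory Defs
  imports "HOL-Analysis.Analysis"
begin

definition convex_body :: "'a::euclidean_space set \<Rightarrow> bool" where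
  "convex_body W \<longleftrightarrow> closed W \<and> convex W \<and> interior W \<noteq> {}"

(* A real-valued infimum: if 0 is interior to W, as in all uses below, the set is nonempty
   and bounded below. *)
definition minkowski_functional :: "'a::euclidean_space set \<Rightarrow> 'a \<Rightarrow> real" where
  "minkowski_functional W x = Inf {l. 0 < l \<and> (1 / l) *\<^sub>R x \<in> W}"

(* Unspecified at points where f is not differentiable. *)
definition gradient :: "('a::euclidean_space \<Rightarrow> real) \<Rightarrow> 'a \<Rightarrow> 'a" where
  "gradient f x = (THE D. GDERIV f x :> D)"

(* Meant for open S. *)
definition C1_on :: "('a::euclidean_space \<Rightarrow> real) \<Rightarrow> 'a set \<Rightarrow> bool" where
  "C1_on f S \<longleftrightarrow> (\<exists>G. (\<forall>x\<in>S. GDERIV f x :> G x) \<and> continuous_on S G)"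

(* Meant for convex bodies with 0 in the interior; the theorem assumes this separately. *)
definition body_of_class_C1 :: "'a::euclidean_space set \<Rightarrow> bool" where
  "body_of_class_C1 W \<longleftrightarrow> C1_on (minkowski_functional W) (UNIV - minkowski_functional W -` {0})"

definition outer_normal :: "'a::euclidean_space set \<Rightarrow> 'a \<Rightarrow> 'a" where
  "outer_normal W x =
     gradient (minkowski_functional W) x /\<^sub>R norm (gradient (minkowski_functional W) x)"

definition orth_proj :: "'a::euclidean_space set \<Rightarrow> 'a \<Rightarrow> 'a" where
  "orth_proj X x = (THE y. y \<in> X \<and> (\<forall>z\<in>X. orthogonal (x - y) z))"

end

theory Submission
  imports Defs
begin

text \<open>
  A convex body \<open>W\<close> with \<open>0\<close> in its interior is the polar of a compact set \<open>D\<close>, and \<open>\<mu>\<^sub>W(x)\<close> is the maximum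
  of \<open>\<langle>\<xi>, x\<rangle>\<close> over \<open>\<xi> \<in> D\<close>. So \<open>W\<close> is of class \<open>C\<^sup>1\<close> iff for \<open>\<mu>\<^sub>W(x) > 0\<close> the maximizer is unique, and then
  it is the gradient. Necessity of (2) is compactness of \<open>D\<close>; for (4) the cones are
  placed beyond supporting half-spaces of \<open>W\<close> whose normals complete \<open>Y\<close> to \<open>X\<close>.

  For sufficiency, put \<open>G(x) = N(x) / \<langle>N(x), x\<rangle>\<close>, add to \<open>G(E)\<close> finitely many functionals obtained
  from the cones that complete \<open>Y\<close> to \<open>X\<close> and are at most \<open>1/2\<close> on \<open>E\<close>, and let \<open>K\<close> be the closure.
  By (2) exactly one element of \<open>K\<close> is tight at each point of the closure of \<open>P(E)\<close>. Enlarging \<open>K\<close> to a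
  convex \<open>D \<subseteq> X\<close> with unique maximizers, without creating new tight functionals on \<open>P(E)\<close>, gives
  \<open>W\<close> as the polar of \<open>D\<close>.
\<close>

section \<open>Orthogonal projection onto a subspace\<close>

lemma orth_proj_props:
  assumes "subspace X"
  shows orth_proj_in: "orth_proj X x \<in> X"
    and orth_proj_orthogonal: "\<And>z. z \<in> X \<Longrightarrow> inner z (orth_proj X x) = inner z x"
    and orth_proj_unique: "\<And>y. y \<in> X \<Longrightarrow> (\<And>z. z \<in> X \<Longrightarrow> inner z y = inner z x) \<Longrightarrow> orth_proj X x = y"
proof -
  have uniq: "y = y'" if "y \<in> X" "y' \<in> X" "\<forall>z\<in>X. orthogonal (x - y) z" "\<forall>z\<in>X. orthogonal (x - y') z" for y y'
  proof -
    have "y - y' \<in> X" using that assms by (simp add: subspace_diff)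
    then have "inner (x - y) (y - y') = 0" "inner (x - y') (y - y') = 0"
      using that by (auto simp: orthogonal_def)
    then have "inner (y - y') (y - y') = 0" by (simp add: inner_diff_left inner_diff_right inner_commute)
    then show ?thesis by simp
  qed
  obtain y z where yz: "y \<in> span X" "\<And>w. w \<in> span X \<Longrightarrow> orthogonal z w" "x = y + z"
    using orthogonal_subspace_decomp_exists by blast
  have sp: "span X = X" using assms by (simp add: span_eq_iff)
  have ex: "\<exists>!y. y \<in> X \<and> (\<forall>z\<in>X. orthogonal (x - y) z)"
    using yz uniq unfolding sp by (intro ex_ex1I) auto
  have P: "orth_proj X x \<in> X \<and> (\<forall>z\<in>X. orthogonal (x - orth_proj X x) z)"
    unfolding orth_proj_def using theI'[OF ex] .
  then show "orth_proj X x \<in> X" by blast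
  show "inner z (orth_proj X x) = inner z x" if "z \<in> X" for z
    using P that by (auto simp: orthogonal_def inner_diff_left inner_commute[of z])
  show "orth_proj X x = y" if "y \<in> X" "\<And>z. z \<in> X \<Longrightarrow> inner z y = inner z x" for y
  proof -
    have "\<forall>z\<in>X. orthogonal (x - y) z"
      using that(2) by (metis eq_iff_diff_eq_0 inner_commute inner_diff_left orthogonal_def)
    then show ?thesis using P that(1) uniq[of "orth_proj X x" y] by blast
  qed
qed

lemma linear_orth_proj:
  assumes "subspace X"
  shows "linear (orth_proj X)"
proof
  fix x y :: 'a and c :: real
  show "orth_proj X (x + y) = orth_proj X x + orth_proj X y"
    by (rule orth_proj_unique[OF assms])
      (auto simp: orth_proj_in assms subspace_add inner_add_right orth_proj_orthogonal)
  show "orth_proj X (c *\<^sub>R x) = c *\<^sub>R orth_proj X x"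
    by (rule orth_proj_unique[OF assms])
      (auto simp: orth_proj_in assms subspace_scale orth_proj_orthogonal)
qed

section \<open>Polars and their Minkowski functionals\<close>

definition polar :: "'a::euclidean_space set \<Rightarrow> 'a set" where
  "polar D = {x. \<forall>\<xi>\<in>D. inner \<xi> x \<le> 1}"

lemma closed_polar: "closed (polar D)"
proof -
  have "polar D = (\<Inter>\<xi>\<in>D. {x. inner \<xi> x \<le> 1})" by (auto simp: polar_def)
  then show ?thesis by (auto intro!: closed_INT closed_halfspace_le)
qed

lemma convex_polar: "convex (polar D)"
proof -
  have "polar D = (\<Inter>\<xi>\<in>D. {x. inner \<xi> x \<le> 1})" by (auto simp: polar_def)
  then show ?thesis by (auto intro!: convex_INT convex_halfspace_le)
qed

lemma zero_in_interior_polar: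
  assumes "bounded D" shows "0 \<in> interior (polar D)"
proof -
  obtain B where B: "B > 0" "\<And>\<xi>. \<xi> \<in> D \<Longrightarrow> norm \<xi> \<le> B"
    using assms bounded_pos by blast
  have "ball 0 (1 / B) \<subseteq> polar D"
  proof (clarsimp simp: polar_def)
    fix x \<xi> :: 'a assume "norm x < 1 / B" "\<xi> \<in> D"
    then have "norm \<xi> * norm x \<le> B * (1 / B)" using B by (intro mult_mono) auto
    then show "inner \<xi> x \<le> 1" using B norm_cauchy_schwarz[of \<xi> x] by simp
  qed
  then show ?thesis using B by (auto simp: mem_interior intro!: exI[of _ "1 / B"])
qed

lemma bounded_polar:
  assumes "0 \<in> interior W" shows "bounded (polar W)"
proof -
  obtain r where r: "r > 0" "cball 0 r \<subseteq> W"
    using assms mem_interior_cball by blast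
  have "norm \<xi> \<le> 1 / r" if "\<xi> \<in> polar W" for \<xi>
  proof (cases "\<xi> = 0")
    case False
    have "(r / norm \<xi>) *\<^sub>R \<xi> \<in> W" using r False by (intro subsetD[OF r(2)]) auto
    then have "inner ((r / norm \<xi>) *\<^sub>R \<xi>) \<xi> \<le> 1" using that by (auto simp: polar_def)
    then have "r * norm \<xi> \<le> 1" using False by (simp add: dot_square_norm power2_eq_square)
    then show ?thesis using r by (simp add: field_simps)
  qed (use r in auto)
  then show ?thesis by (auto simp: bounded_iff)
qed

lemma polar_polar:
  assumes "closed W" "convex W" "0 \<in> W" shows "polar (polar W) = W"
proof
  show "W \<subseteq> polar (polar W)" by (auto simp: polar_def inner_commute)
  show "polar (polar W) \<subseteq> W"
  proof (rule ccontr)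
    assume "\<not> polar (polar W) \<subseteq> W"
    then obtain x where x: "x \<in> polar (polar W)" "x \<notin> W" by blast
    obtain a b where ab: "inner a x < b" "\<And>w. w \<in> W \<Longrightarrow> inner a w > b"
      using separating_hyperplane_closed_point[OF assms(2,1) x(2)] by blast
    \<comment> \<open>Since \<open>W\<close> contains 0, \<open>b\<close> is negative: dividing by
      it reverses the inequalities and turns the separating functional into a point of
      \<open>polar W\<close> that exceeds 1 at \<open>x\<close>.\<close>
    have b: "b < 0" using ab(2)[OF assms(3)] by simp
    have "inner (a /\<^sub>R b) w \<le> 1" if "w \<in> W" for w
      using ab(2)[OF that] b by (simp add: field_simps)
    then have "a /\<^sub>R b \<in> polar W" by (simp only: polar_def mem_Collect_eq inner_commute[of _ "a /\<^sub>R b"]) blast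
    then have "inner (a /\<^sub>R b) x \<le> 1" using x(1) unfolding polar_def by blast
    then show False using ab(1) b by (simp add: field_simps)
  qed
qed

lemma minkowski_functional_polar:
  assumes "0 \<in> D" "\<And>\<xi>. \<xi> \<in> D \<Longrightarrow> inner \<xi> x \<le> M" "\<exists>\<xi>\<in>D. inner \<xi> x = M"
  shows "minkowski_functional (polar D) x = M"
proof -
  have M: "M \<ge> 0" using assms(1,2) by force
  have eq: "{l. 0 < l \<and> (1 / l) *\<^sub>R x \<in> polar D} = {l. 0 < l \<and> M \<le> l}"
    using assms(2,3) by (force simp: polar_def field_simps)
  \<comment> \<open>For \<open>M = 0\<close> the admissible scalars form an open half-line, whose
    infimum is not attained; hence the separate case.\<close>
  show ?thesis
  proof (cases "M = 0")
    case True
    then have "{l. 0 < l \<and> M \<le> l} = {0<..}" by auto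
    then show ?thesis unfolding minkowski_functional_def eq using True by simp
  next
    case False
    then have "{l. 0 < l \<and> M \<le> l} = {M..}" using M by auto
    then show ?thesis unfolding minkowski_functional_def eq by simp
  qed
qed

lemma minkowski_functional_polar_attained:
  assumes "compact D" "0 \<in> D"
  shows "\<exists>\<xi>\<in>D. inner \<xi> x = minkowski_functional (polar D) x"
    and "\<And>\<xi>. \<xi> \<in> D \<Longrightarrow> inner \<xi> x \<le> minkowski_functional (polar D) x"
proof -
  have "continuous_on D (\<lambda>\<xi>. inner \<xi> x)" by (intro continuous_intros)
  then obtain \<xi> where \<xi>: "\<xi> \<in> D" "\<And>\<zeta>. \<zeta> \<in> D \<Longrightarrow> inner \<zeta> x \<le> inner \<xi> x"
    using continuous_attains_sup[OF assms(1)] assms(2) by blast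
  have "minkowski_functional (polar D) x = inner \<xi> x"
    using \<xi> assms by (intro minkowski_functional_polar) auto
  with \<xi> show "\<exists>\<xi>\<in>D. inner \<xi> x = minkowski_functional (polar D) x"
    and "\<And>\<xi>. \<xi> \<in> D \<Longrightarrow> inner \<xi> x \<le> minkowski_functional (polar D) x" by auto
qed

lemma minkowski_functional_polar_nonneg:
  assumes "compact D" "0 \<in> D"
  shows "minkowski_functional (polar D) x \<ge> 0"
  using minkowski_functional_polar_attained(2)[OF assms assms(2), of x] by simp

lemma minkowski_functional_polar_scale:
  assumes "compact D" "0 \<in> D" "c \<ge> 0"
  shows "minkowski_functional (polar D) (c *\<^sub>R x) = c * minkowski_functional (polar D) x"
  using minkowski_functional_polar_attained(1)[OF assms(1,2), of x]
    minkowski_functional_polar_attained(2)[OF assms(1,2), where x = x] assms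
  by (intro minkowski_functional_polar) (auto simp: mult_left_mono)

text \<open>The interior is the strict sublevel set of the Minkowski functional: an interior point
  can be stretched slightly and still have value at most 1, and boundedness of \<open>D\<close>
  gives a ball around each point of value below 1.\<close>

lemma frontier_polar:
  assumes "compact D" "0 \<in> D"
  shows "frontier (polar D) = {x. minkowski_functional (polar D) x = 1}"
proof -
  let ?\<mu> = "minkowski_functional (polar D)"
  have mem: "x \<in> polar D \<longleftrightarrow> ?\<mu> x \<le> 1" for x
    using minkowski_functional_polar_attained(1)[OF assms, of x]
      minkowski_functional_polar_attained(2)[OF assms, where x = x] by (fastforce simp: polar_def)
  obtain B where B: "B > 0" "\<And>\<xi>. \<xi> \<in> D \<Longrightarrow> norm \<xi> \<le> B"
    using compact_imp_bounded[OF assms(1)] bounded_pos by blast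
  have int: "x \<in> interior (polar D) \<longleftrightarrow> ?\<mu> x < 1" for x
  proof
    assume "x \<in> interior (polar D)"
    then obtain e where e: "e > 0" "cball x e \<subseteq> polar D" using mem_interior_cball by blast
    \<comment> \<open>Chosen so that \<open>t * norm x \<le> e\<close>; the summand 1 covers
      \<open>x = 0\<close>.\<close>
    define t where "t = e / (norm x + 1)"
    have n: "norm x + 1 > 0" using norm_ge_zero[of x] by linarith
    have t: "t > 0" using e(1) n by (simp add: t_def)
    have "e * norm x \<le> e * (norm x + 1)" using e by simp
    then have "t * norm x \<le> e" using e n by (simp add: t_def field_simps)
    then have "(1 + t) *\<^sub>R x \<in> cball x e" using t by (simp add: dist_norm algebra_simps)
    then have "(1 + t) * ?\<mu> x \<le> 1"
      using e(2) mem[of "(1 + t) *\<^sub>R x"] minkowski_functional_polar_scale[OF assms, of "1 + t" x] t by auto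
    show "?\<mu> x < 1"
    proof (rule ccontr)
      assume "\<not> ?\<mu> x < 1"
      then have "(1 + t) * 1 \<le> (1 + t) * ?\<mu> x" using t by (intro mult_left_mono) auto
      also have "\<dots> \<le> 1" by fact
      finally show False using t by simp
    qed
  next
    assume l: "?\<mu> x < 1"
    have "ball x ((1 - ?\<mu> x) / B) \<subseteq> polar D"
    proof
      fix y assume "y \<in> ball x ((1 - ?\<mu> x) / B)"
      then have n: "norm (y - x) \<le> (1 - ?\<mu> x) / B" by (simp add: dist_norm norm_minus_commute)
      have "inner \<xi> y \<le> 1" if "\<xi> \<in> D" for \<xi>
      proof -
        have "inner \<xi> (y - x) \<le> norm \<xi> * norm (y - x)" by (rule norm_cauchy_schwarz)
        also have "\<dots> \<le> B * ((1 - ?\<mu> x) / B)" using B that n by (intro mult_mono) auto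
        finally show ?thesis
          using minkowski_functional_polar_attained(2)[OF assms that, of x] B
          by (simp add: inner_diff_right)
      qed
      then show "y \<in> polar D" by (auto simp: polar_def)
    qed
    then show "x \<in> interior (polar D)" using l B
      by (auto simp: mem_interior intro!: exI[of _ "(1 - ?\<mu> x) / B"])
  qed
  show ?thesis using mem int closed_polar[of D] by (force simp: frontier_def)
qed

lemma convex_body_polar:
  assumes "compact D"
  shows "convex_body (polar D)" "0 \<in> interior (polar D)"
  using closed_polar convex_polar zero_in_interior_polar[OF compact_imp_bounded[OF assms]]
  by (auto simp: convex_body_def)

section \<open>Gradients as unique maximizers\<close>

text \<open>Subtracting a tight functional from the Minkowski functional leaves a function with a
  global minimum at \<open>x\<close>, so its derivative there vanishes.\<close>

lemma GDERIV_minkowski_unique: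
  assumes "compact D" "0 \<in> D" and g: "GDERIV (minkowski_functional (polar D)) x :> g"
    and "\<xi> \<in> D" "inner \<xi> x = minkowski_functional (polar D) x"
  shows "\<xi> = g"
proof -
  let ?f = "\<lambda>y. minkowski_functional (polar D) y - inner y \<xi>"
  have d: "(?f has_derivative (\<lambda>h. inner h g - inner h \<xi>)) (at x)"
    using g unfolding gderiv_def
    by (intro has_derivative_diff has_derivative_inner_left has_derivative_ident)
  have "?f x \<le> ?f y" for y
    using minkowski_functional_polar_attained(2)[OF assms(1,2,4), of y] assms(5)
    by (simp add: inner_commute)
  then have "(\<lambda>h. inner h g - inner h \<xi>) = (\<lambda>h. 0)"
    using differential_zero_maxmin[OF _ open_UNIV d] by auto
  then have "inner (g - \<xi>) g - inner (g - \<xi>) \<xi> = 0" by meson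
  then have "inner (g - \<xi>) (g - \<xi>) = 0" by (simp add: inner_diff_right)
  then show ?thesis by simp
qed

lemma GDERIV_unique:
  assumes "GDERIV f x :> a" "GDERIV f x :> b" shows "a = b"
proof -
  have "(\<lambda>h. inner h a) = (\<lambda>h. inner h b)"
    using assms has_derivative_unique unfolding gderiv_def by blast
  then have "inner (a - b) a = inner (a - b) b" by meson
  then have "inner (a - b) (a - b) = 0" by (simp add: inner_diff_right)
  then show ?thesis by simp
qed

lemma gradient_eq: "GDERIV f x :> g \<Longrightarrow> gradient f x = g"
  unfolding gradient_def using GDERIV_unique by (intro the_equality)

text \<open>An envelope argument. Uniqueness gives the maximizer a closed graph with values in a
  compact set, hence continuity, and the increment of the Minkowski functional is squeezed between
  the maximizers at the two end points.\<close>

lemma polar_body_of_class_C1: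
  assumes D: "compact D" "0 \<in> D"
    and uniq: "\<And>x \<xi> \<zeta>. \<lbrakk>minkowski_functional (polar D) x > 0; \<xi> \<in> D; \<zeta> \<in> D;
      inner \<xi> x = minkowski_functional (polar D) x; inner \<zeta> x = minkowski_functional (polar D) x\<rbrakk> \<Longrightarrow> \<xi> = \<zeta>"
  shows "body_of_class_C1 (polar D)"
    and "\<And>x \<xi>. \<lbrakk>minkowski_functional (polar D) x > 0; \<xi> \<in> D; inner \<xi> x = minkowski_functional (polar D) x\<rbrakk>
      \<Longrightarrow> GDERIV (minkowski_functional (polar D)) x :> \<xi>"
proof -
  let ?\<mu> = "minkowski_functional (polar D)"
  define S where "S = UNIV - ?\<mu> -` {0}"
  have S: "x \<in> S \<longleftrightarrow> ?\<mu> x > 0" for x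
    using minkowski_functional_polar_nonneg[OF D, of x] by (auto simp: S_def)
  obtain B where B: "B > 0" "\<And>\<xi>. \<xi> \<in> D \<Longrightarrow> norm \<xi> \<le> B"
    using compact_imp_bounded[OF D(1)] bounded_pos by blast
  have lip: "?\<mu> x - ?\<mu> y \<le> B * norm (x - y)" for x y
  proof -
    obtain \<xi> where \<xi>: "\<xi> \<in> D" "inner \<xi> x = ?\<mu> x"
      using minkowski_functional_polar_attained(1)[OF D] by blast
    have "?\<mu> x - ?\<mu> y \<le> inner \<xi> (x - y)"
      using \<xi> minkowski_functional_polar_attained(2)[OF D \<xi>(1), of y] by (simp add: inner_diff_right)
    also have "\<dots> \<le> norm \<xi> * norm (x - y)" by (rule norm_cauchy_schwarz)
    also have "\<dots> \<le> B * norm (x - y)" using B \<xi> by (intro mult_right_mono) auto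
    finally show ?thesis .
  qed
  have "\<bar>?\<mu> x - ?\<mu> y\<bar> \<le> B * norm (x - y)" for x y
    using lip[of x y] lip[of y x] by (simp add: norm_minus_commute abs_le_iff)
  then have "B-lipschitz_on UNIV ?\<mu>" using B by (auto simp: lipschitz_on_def dist_norm)
  then have cont: "continuous_on UNIV ?\<mu>" by (rule lipschitz_on_continuous_on)
  have opS: "open S"
    unfolding S_def
    using closed_vimage[OF closed_singleton cont] by (intro open_Diff open_UNIV)
  have "\<forall>x. \<exists>\<xi>. \<xi> \<in> D \<and> inner \<xi> x = ?\<mu> x"
    using minkowski_functional_polar_attained(1)[OF D] by blast
  then obtain G where G: "\<And>x. G x \<in> D" "\<And>x. inner (G x) x = ?\<mu> x" by metis
  have contG: "continuous_on S G"
  proof -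
    have GD: "G \<in> S \<rightarrow> D" using G by auto
    \<comment> \<open>By uniqueness the graph of \<open>G\<close> consists of all tight pairs, a
      relatively closed condition.\<close>
    have eq: "(\<lambda>x. (x, G x)) ` S = (S \<times> D) \<inter> {p. inner (snd p) (fst p) - ?\<mu> (fst p) = 0}"
      using G uniq S by (auto simp: image_iff) 
    have c: "continuous_on UNIV (\<lambda>p. inner (snd p) (fst p) - ?\<mu> (fst p))"
      by (intro continuous_intros continuous_on_compose2[OF cont]) auto
    have "closed {p::'a\<times>'a. inner (snd p) (fst p) - ?\<mu> (fst p) = 0}"
      using closed_vimage[OF closed_singleton[of 0] c] by (simp add: vimage_def)
    then have "closedin (top_of_set (S \<times> D)) ((\<lambda>x. (x, G x)) ` S)"
      unfolding eq by (rule closedin_closed_Int)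
    then show ?thesis using continuous_closed_graph_eq[OF D(1) GD] by blast
  qed
  have deriv: "GDERIV ?\<mu> x :> G x" if xS: "x \<in> S" for x
    unfolding gderiv_def has_derivative_at_alt
  proof (intro conjI allI impI)
    show "bounded_linear (\<lambda>h. inner h (G x))" by (rule bounded_linear_inner_left)
    fix e :: real assume e: "e > 0"
    obtain d1 where d1: "d1 > 0" "\<And>y. y \<in> S \<Longrightarrow> dist y x < d1 \<Longrightarrow> dist (G y) (G x) < e"
      using contG[unfolded continuous_on_iff, rule_format, OF xS e] by blast
    obtain d2 where d2: "d2 > 0" "ball x d2 \<subseteq> S" using opS xS openE by blast
    show "\<exists>d>0. \<forall>y. norm (y - x) < d \<longrightarrow> norm (?\<mu> y - ?\<mu> x - inner (y - x) (G x)) \<le> e * norm (y - x)"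
    proof (intro exI[of _ "min d1 d2"] conjI allI impI)
      show "min d1 d2 > 0" using d1 d2 by simp
      fix y assume y: "norm (y - x) < min d1 d2"
      then have "y \<in> S" using d2 by (auto simp: dist_norm norm_minus_commute)
      then have ge: "norm (G y - G x) < e" using d1(2)[of y] y by (simp add: dist_norm)
      \<comment> \<open>\<open>G x\<close> competes at \<open>y\<close> for the lower bound and
        \<open>G y\<close> competes at \<open>x\<close> for the upper bound; continuity of
        \<open>G\<close> closes the gap.\<close>
      have lo: "0 \<le> ?\<mu> y - ?\<mu> x - inner (y - x) (G x)"
        using minkowski_functional_polar_attained(2)[OF D G(1)[of x], of y] G(2)[of x]
        by (simp add: inner_diff_right inner_commute[of _ "G x"])
      have "?\<mu> y - ?\<mu> x - inner (y - x) (G x) \<le> inner (G y - G x) (y - x)"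
        using minkowski_functional_polar_attained(2)[OF D G(1)[of y], of x] G(2)[of y]
        by (simp add: inner_diff_left inner_diff_right inner_commute)
      also have "\<dots> \<le> norm (G y - G x) * norm (y - x)" by (rule norm_cauchy_schwarz)
      also have "\<dots> \<le> e * norm (y - x)" using ge by (intro mult_right_mono) auto
      finally show "norm (?\<mu> y - ?\<mu> x - inner (y - x) (G x)) \<le> e * norm (y - x)"
        using lo by simp
    qed
  qed
  show "body_of_class_C1 (polar D)"
    unfolding body_of_class_C1_def C1_on_def S_def[symmetric] using deriv contG by blast
  show "GDERIV ?\<mu> x :> \<xi>" if "?\<mu> x > 0" "\<xi> \<in> D" "inner \<xi> x = ?\<mu> x" for x \<xi>
    using deriv[of x] uniq[OF that(1,2) G(1)[of x] that(3) G(2)] S that by simp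
qed

section \<open>Enlarging a compact set to one with unique maximizers\<close>

text \<open>\<open>v\<close> is a relative interior point of the convex hull of \<open>K\<close> and
  0, whose affine hull is \<open>span K\<close>. A ball of radius \<eta> around it within
  \<open>span K\<close> consists of functionals at most 1 on the polar; shifting \<open>v\<close> by
  \<eta> towards the projection of \<open>x\<close> gives the estimate.\<close>

lemma coercive_polar:
  fixes K :: "'a::euclidean_space set"
  obtains v \<eta> where "v \<in> span K" "\<eta> > 0"
    "\<And>x. x \<in> polar K \<Longrightarrow> \<eta> * norm (orth_proj (span K) x) \<le> 1 - inner v x"
proof -
  let ?C = "convex hull (insert 0 K)"
  have ne: "rel_interior ?C \<noteq> {}" by (simp add: rel_interior_eq_empty)
  then obtain v where v: "v \<in> rel_interior ?C" by blast
  have aff: "affine hull ?C = span K"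
    using affine_hull_span_0[of "insert 0 K"] by (simp add: hull_inc)
  obtain \<eta> where \<eta>: "\<eta> > 0" "cball v \<eta> \<inter> span K \<subseteq> ?C" "v \<in> ?C"
    using v unfolding mem_rel_interior_cball aff by blast
  have vK: "v \<in> span K" using \<eta>(3) hull_subset[of ?C affine] aff by blast
  have hull: "inner z x \<le> 1" if "x \<in> polar K" "z \<in> ?C" for x z
  proof -
    have "?C \<subseteq> {z. inner x z \<le> 1}"
      using that(1) by (intro hull_minimal convex_halfspace_le) (auto simp: polar_def inner_commute)
    then show ?thesis using that(2) by (auto simp: inner_commute)
  qed
  have "\<eta> * norm (orth_proj (span K) x) \<le> 1 - inner v x" if x: "x \<in> polar K" for x
  proof (cases "orth_proj (span K) x = 0")
    case True
    then show ?thesis using hull[OF x \<eta>(3)] by simp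
  next
    case False
    define p where "p = orth_proj (span K) x"
    have p: "p \<in> span K" "p \<noteq> 0" using False orth_proj_in[of "span K"] by (auto simp: p_def)
    have pp: "inner p x = norm p * norm p"
      using orth_proj_orthogonal[of "span K" p x] p
      by (simp add: p_def[symmetric] dot_square_norm power2_eq_square)
    define z where "z = v + (\<eta> / norm p) *\<^sub>R p"
    have "z \<in> span K" using vK p by (simp add: z_def span_add span_scale)
    moreover have "z \<in> cball v \<eta>" using \<eta>(1) p by (simp add: z_def dist_norm)
    ultimately have "inner z x \<le> 1" using hull[OF x] \<eta>(2) by blast
    then have "inner v x + (\<eta> / norm p) * (norm p * norm p) \<le> 1"
      by (simp add: z_def inner_add_left pp)
    then show ?thesis using p by (simp add: p_def[symmetric])
  qed
  then show ?thesis using that vK \<eta>(1) by blast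
qed

text \<open>A truncated squared distance. The quadratic bound makes the gap negligible to first
  order along rays leaving \<open>E\<close>; the bound \<open>1 / 2\<close> leaves room around 0
  when constraints are tightened by the gap.\<close>

lemma gap_function:
  fixes E :: "'a::euclidean_space set"
  assumes "closed E"
  obtains \<delta> :: "'a \<Rightarrow> real" where "continuous_on UNIV \<delta>" "\<And>y. \<delta> y \<ge> 0" "\<And>y. \<delta> y \<le> 1 / 2"
    "\<And>y. \<delta> y = 0 \<longleftrightarrow> y \<in> E" "\<And>a y. a \<in> E \<Longrightarrow> \<delta> y \<le> (dist y a)\<^sup>2"
proof (cases "E = {}")
  case True
  \<comment> \<open>\<open>infdist\<close> to the empty set is 0, so the general formula would
    vanish everywhere.\<close>
  show ?thesis by (rule that[of "\<lambda>_. 1 / 2"]) (auto simp: True)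
next
  case False
  show ?thesis
  proof (rule that[of "\<lambda>y. min (1 / 2) ((infdist y E)\<^sup>2)"])
    show "continuous_on UNIV (\<lambda>y. min (1 / 2) ((infdist y E)\<^sup>2))"
      by (intro continuous_intros)
    show "min (1 / 2) ((infdist y E)\<^sup>2) = 0 \<longleftrightarrow> y \<in> E" for y
      using in_closed_iff_infdist_zero[OF assms False, of y] by (auto simp: min_def)
    show "min (1 / 2) ((infdist y E)\<^sup>2) \<le> (dist y a)\<^sup>2" if "a \<in> E" for a y
      using power_mono[OF infdist_le[OF that, of y] infdist_nonneg, of 2] by simp
  qed auto
qed

text \<open>
  Here \<open>S\<close> is \<open>polar K\<close> (inside \<open>X\<close>) pulled in by the gap \<open>\<delta>\<close>, which vanishes exactly on \<open>E\<close>,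
  and \<open>D\<close> is the polar of the union of the balls of radius \<open>\<delta> y / L\<close> around the points \<open>y\<close> of \<open>S\<close>.
\<close>
lemma enlarge_to_unique_maximizers:
  fixes K E X :: "'a::euclidean_space set"
  assumes X: "subspace X" and K: "compact K" "span K = X"
    and E: "closed E" "E \<subseteq> X"
    and le: "\<And>\<xi> x. \<lbrakk>\<xi> \<in> K; x \<in> E\<rbrakk> \<Longrightarrow> inner \<xi> x \<le> 1"
    and ex1: "\<And>x. x \<in> E \<Longrightarrow> \<exists>!\<xi>. \<xi> \<in> K \<and> inner \<xi> x = 1"
  obtains D where "compact D" "0 \<in> D" "D \<subseteq> X" "K \<subseteq> D"
    "\<And>\<xi> x. \<lbrakk>\<xi> \<in> D; x \<in> E\<rbrakk> \<Longrightarrow> inner \<xi> x \<le> 1"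
    "\<And>x \<xi> \<zeta>. \<lbrakk>minkowski_functional (polar D) x > 0; \<xi> \<in> D; \<zeta> \<in> D;
      inner \<xi> x = minkowski_functional (polar D) x;
      inner \<zeta> x = minkowski_functional (polar D) x\<rbrakk> \<Longrightarrow> \<xi> = \<zeta>"
proof -
  have KX: "K \<subseteq> X" using K(2) span_superset by blast
  obtain B where B: "\<And>\<xi>. \<xi> \<in> K \<Longrightarrow> norm \<xi> \<le> B"
    using compact_imp_bounded[OF K(1)] bounded_pos by blast
  \<comment> \<open>\<open>L\<close> bounds the norms on \<open>K\<close>, which gives
    \<open>K \<subseteq> D\<close> below; \<open>L \<ge> 1\<close> keeps
    \<open>\<delta> y / L\<close> at most 1.\<close>
  define L where "L = max 1 B"
  have L: "L > 0" "\<And>\<xi>. \<xi> \<in> K \<Longrightarrow> norm \<xi> \<le> L" "L \<ge> 1"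
    using B by (force simp: L_def)+
  obtain \<delta> :: "'a \<Rightarrow> real" where \<delta>: "continuous_on UNIV \<delta>" "\<And>y. \<delta> y \<ge> 0" "\<And>y. \<delta> y \<le> 1 / 2"
    "\<And>y. \<delta> y = 0 \<longleftrightarrow> y \<in> E" "\<And>a y. a \<in> E \<Longrightarrow> \<delta> y \<le> (dist y a)\<^sup>2"
    using gap_function[OF E(1)] by blast
  obtain v \<eta> where v: "v \<in> X" "\<eta> > 0"
    "\<And>x. x \<in> polar K \<Longrightarrow> \<eta> * norm (orth_proj X x) \<le> 1 - inner v x"
    using coercive_polar[of K] unfolding K(2) by blast
  define S where "S = {y \<in> X. \<forall>\<xi>\<in>K. inner \<xi> y + \<delta> y \<le> 1}"
  \<comment> \<open>The maximum of the functional \<xi> over the closed ball of radius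
    \<open>\<delta> y / L\<close> about \<open>y\<close>. The norm term is the source of strict
    convexity off \<open>E\<close>.\<close>
  define \<phi> where "\<phi> = (\<lambda>\<xi> y. inner \<xi> y + \<delta> y / L * norm \<xi>)"
  define D where "D = {\<xi> \<in> X. \<forall>y\<in>S. \<phi> \<xi> y \<le> 1}"
  have zeroS: "0 \<in> S" using \<delta>(3)[of 0] by (simp add: S_def X subspace_0)
  have coer: "\<eta> * norm y \<le> 1 - inner v y" if "y \<in> S" for y
  proof -
    have "y \<in> polar K" using that \<delta>(2)[of y] by (fastforce simp: S_def polar_def)
    moreover have "orth_proj X y = y" using that by (intro orth_proj_unique X) (auto simp: S_def)
    ultimately show ?thesis using v(3) by metis
  qed
  have ES: "E \<subseteq> S"
  proof
    fix x assume "x \<in> E"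
    moreover have "\<delta> x = 0" using \<delta>(4) \<open>x \<in> E\<close> by blast
    ultimately show "x \<in> S" using le E(2) by (auto simp: S_def)
  qed
  have closS: "closed S"
  proof -
    have c: "continuous_on UNIV (\<lambda>y. inner \<xi> y + \<delta> y)" for \<xi>
      using \<delta>(1) by (intro continuous_intros)
    have "S = X \<inter> (\<Inter>\<xi>\<in>K. (\<lambda>y. inner \<xi> y + \<delta> y) -` {..1})" by (auto simp: S_def)
    then show ?thesis using closed_subspace[OF X] closed_vimage[OF closed_atMost c] by auto
  qed
  have KD: "K \<subseteq> D"
  proof
    fix \<xi> assume \<xi>: "\<xi> \<in> K"
    have "\<phi> \<xi> y \<le> 1" if "y \<in> S" for y
    proof -
      have "\<delta> y / L * norm \<xi> \<le> \<delta> y / L * L" using L \<xi> \<delta>(2)[of y] by (intro mult_left_mono) auto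
      then show ?thesis using that \<xi> L(1) by (force simp: S_def \<phi>_def)
    qed
    then show "\<xi> \<in> D" using \<xi> KX by (auto simp: D_def)
  qed
  have zeroD: "0 \<in> D" by (simp add: D_def \<phi>_def X subspace_0)
  have leD: "inner \<xi> x \<le> 1" if "\<xi> \<in> D" "x \<in> E" for \<xi> x
    using that ES \<delta>(4) by (force simp: D_def \<phi>_def)
  have le1: "inner \<xi> y \<le> 1" if "\<xi> \<in> D" "y \<in> S" for \<xi> y
  proof -
    have "\<phi> \<xi> y \<le> 1" using that by (auto simp: D_def)
    moreover have "\<delta> y / L * norm \<xi> \<ge> 0" using \<delta>(2) L(1) by simp
    ultimately show ?thesis by (simp add: \<phi>_def)
  qed
  have closD: "closed D"
  proof -
    have c: "continuous_on UNIV (\<lambda>\<xi>. \<phi> \<xi> y)" for y unfolding \<phi>_def by (intro continuous_intros)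
    have "D = X \<inter> (\<Inter>y\<in>S. (\<lambda>\<xi>. \<phi> \<xi> y) -` {..1})" by (auto simp: D_def)
    then show ?thesis using closed_subspace[OF X] closed_vimage[OF closed_atMost c] by auto
  qed
  have bD: "norm \<xi> \<le> 2 * L" if "\<xi> \<in> D" for \<xi>
  proof (cases "\<xi> = 0")
    case False
    \<comment> \<open>A test point of norm \<open>1 / (2 * L)\<close>: elements of \<open>K\<close>
      are at most \<open>1 / 2\<close> there, and so is the gap, so it lies in
      \<open>S\<close>.\<close>
    define y where "y = (1 / (2 * L * norm \<xi>)) *\<^sub>R \<xi>"
    have ny: "norm y = 1 / (2 * L)" using False L(1) by (simp add: y_def)
    have yX: "y \<in> X" using that X by (auto simp: y_def D_def subspace_scale)
    have "inner \<zeta> y + \<delta> y \<le> 1" if "\<zeta> \<in> K" for \<zeta>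
    proof -
      have "inner \<zeta> y \<le> norm \<zeta> * norm y" by (rule norm_cauchy_schwarz)
      also have "\<dots> \<le> L * (1 / (2 * L))" unfolding ny using L that by (intro mult_right_mono) auto
      finally show ?thesis using \<delta>(3)[of y] L(1) by simp
    qed
    then have "y \<in> S" using yX by (auto simp: S_def)
    then have "inner \<xi> y \<le> 1" using le1 that by blast
    then show ?thesis using False L(1)
      by (simp add: y_def dot_square_norm power2_eq_square field_simps)
  qed (use L in auto)
  have compD: "compact D" using closD bD by (auto simp: compact_eq_bounded_closed bounded_iff)

  txt \<open>
    As \<open>\<delta>\<close> vanishes to second order at \<open>y\<close>, every direction \<open>h\<close> of the open half-space given by the
    unique \<open>\<zeta>\<close> enters \<open>S\<close>, so no other \<open>\<xi> \<in> D\<close> can be tight at \<open>y\<close>.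
  \<close>
  have tight_unique: "\<xi> = \<zeta>" if y: "y \<in> E" and \<zeta>: "\<zeta> \<in> K" "inner \<zeta> y = 1" and \<xi>: "\<xi> \<in> D" "inner \<xi> y = 1" for y \<xi> \<zeta>
  proof (rule ccontr)
    assume ne: "\<xi> \<noteq> \<zeta>"
    define d where "d = \<xi> - \<zeta>"
    \<comment> \<open>Correcting \<open>d\<close> by a multiple of \<open>y\<close>, where both
      functionals equal 1, makes their values at \<open>h\<close> opposite: half of
      \<open>inner d d\<close> and its negative.\<close>
    define h where "h = d - ((inner \<xi> d + inner \<zeta> d) / 2) *\<^sub>R y"
    have dd: "inner \<xi> d - inner \<zeta> d = inner d d" by (simp add: d_def inner_diff_left)
    have dpos: "inner d d > 0" using ne by (simp add: d_def)
    have h\<xi>: "inner \<xi> h = inner d d / 2" and h\<zeta>: "inner \<zeta> h = - inner d d / 2"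
      using \<xi>(2) \<zeta>(2) dd by (auto simp: h_def inner_diff_right field_simps)
    have hX: "h \<in> X" using \<xi>(1) \<zeta>(1) KX y E(2) X
      by (auto simp: h_def d_def D_def intro!: subspace_diff subspace_scale)
    \<comment> \<open>Otherwise the constraints violated at \<open>y + t k *\<^sub>R h\<close>
      subconverge to a functional tight at \<open>y\<close>, which is \<zeta>. The gap is of order
      \<open>t k\<close> squared, so dividing by \<open>t k\<close> gives
      \<open>inner \<zeta> h \<ge> 0\<close>, against the choice of \<open>h\<close>.\<close>
    have "\<exists>t>0. y + t *\<^sub>R h \<in> S"
    proof (rule ccontr)
      assume neg: "\<not> (\<exists>t>0. y + t *\<^sub>R h \<in> S)"
      define t where "t = (\<lambda>k. 1 / real (Suc k))"
      have tpos: "t k > 0" for k by (simp add: t_def)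
      have yX: "y + t k *\<^sub>R h \<in> X" for k using y E(2) hX X by (auto intro!: subspace_add subspace_scale)
      have "\<forall>k. \<exists>\<zeta>'\<in>K. inner \<zeta>' (y + t k *\<^sub>R h) + \<delta> (y + t k *\<^sub>R h) > 1"
        using neg tpos yX by (force simp: S_def not_le)
      then obtain z where z: "\<And>k. z k \<in> K" "\<And>k. inner (z k) (y + t k *\<^sub>R h) + \<delta> (y + t k *\<^sub>R h) > 1"
        by metis
      have dl: "\<delta> (y + t k *\<^sub>R h) \<le> t k * (t k * (norm h)\<^sup>2)" for k
        using \<delta>(5)[OF y, of "y + t k *\<^sub>R h"] tpos[of k]
        by (simp add: dist_norm power_mult_distrib power2_eq_square mult.assoc mult.left_commute)
      have z1: "inner (z k) y + t k * inner (z k) h + t k * (t k * (norm h)\<^sup>2) > 1" for k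
        using z(2)[of k] dl[of k] by (simp add: inner_add_right)
      have z2: "inner (z k) h + t k * (norm h)\<^sup>2 > 0" for k
      proof -
        have "t k * (inner (z k) h + t k * (norm h)\<^sup>2) > 0"
          using z1[of k] le[OF z(1) y, of k] by (simp add: distrib_left)
        then show ?thesis using tpos[of k] zero_less_mult_pos by blast
      qed
      obtain \<zeta>' r where r: "\<zeta>' \<in> K" "strict_mono r" "(z \<circ> r) \<longlonglongrightarrow> \<zeta>'"
        using K(1) z(1) unfolding compact_def by metis
      have zr: "(\<lambda>k. z (r k)) \<longlonglongrightarrow> \<zeta>'" using r(3) by (simp add: o_def)
      have "t \<longlonglongrightarrow> 0" unfolding t_def by (rule LIMSEQ_Suc[OF lim_1_over_n])
      then have tr: "(\<lambda>k. t (r k)) \<longlonglongrightarrow> 0"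
        using LIMSEQ_subseq_LIMSEQ[OF _ r(2)] by (force simp: o_def)
      have "(\<lambda>k. inner (z (r k)) y + t (r k) * inner (z (r k)) h + t (r k) * (t (r k) * (norm h)\<^sup>2))
          \<longlonglongrightarrow> inner \<zeta>' y + 0 * inner \<zeta>' h + 0 * (0 * (norm h)\<^sup>2)"
        by (intro tendsto_intros zr tr)
      then have "inner \<zeta>' y + 0 * inner \<zeta>' h + 0 * (0 * (norm h)\<^sup>2) \<ge> 1"
        by (rule LIMSEQ_le_const) (auto intro!: exI[of _ 0] less_imp_le[OF z1])
      then have "inner \<zeta>' y = 1" using le[OF r(1) y] by simp
      then have "\<zeta>' = \<zeta>" using ex1[OF y] r(1) \<zeta> by blast
      have "(\<lambda>k. inner (z (r k)) h + t (r k) * (norm h)\<^sup>2) \<longlonglongrightarrow> inner \<zeta>' h + 0 * (norm h)\<^sup>2"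
        by (intro tendsto_intros zr tr)
      then have "inner \<zeta>' h + 0 * (norm h)\<^sup>2 \<ge> 0"
        by (rule LIMSEQ_le_const) (auto intro!: exI[of _ 0] less_imp_le[OF z2] simp del: mult_eq_0_iff)
      then show False using h\<zeta> dpos \<open>\<zeta>' = \<zeta>\<close> by simp
    qed
    then obtain t where t: "t > 0" "y + t *\<^sub>R h \<in> S" by blast
    have "inner \<xi> (y + t *\<^sub>R h) \<le> 1" using le1[OF \<xi>(1) t(2)] .
    then have "t * (inner d d / 2) \<le> 0" by (simp add: inner_add_right \<xi>(2) h\<xi>)
    then show False using t(1) dpos by (simp add: mult_le_0_iff)
  qed

  txt \<open>
    Otherwise \<open>(1 + s c) \<xi> + s v\<close> lies in \<open>D\<close> for small \<open>s > 0\<close> and does better than \<open>\<xi>\<close> at \<open>x\<close>; the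
    coercive term \<open>s v\<close> takes care of the unbounded part of \<open>S\<close>.
  \<close>
  have tight_ex: "\<exists>y\<in>S. \<phi> \<xi> y = 1"
    if \<xi>: "\<xi> \<in> D" and pos: "inner \<xi> x > 0" and max: "\<And>\<zeta>. \<zeta> \<in> D \<Longrightarrow> inner \<zeta> x \<le> inner \<xi> x" for \<xi> x
  proof (rule ccontr)
    assume neg: "\<not> (\<exists>y\<in>S. \<phi> \<xi> y = 1)"
    define M where "M = inner \<xi> x"
    \<comment> \<open>The scaling gain \<open>c * M\<close> outweighs a possible loss
      \<open>inner v x\<close> by at least 1.\<close>
    define c where "c = (\<bar>inner v x\<bar> + 1) / M"
    have M: "M > 0" using pos by (simp add: M_def)
    have c: "c > 0" unfolding c_def using M by simp
    \<comment> \<open>Beyond this radius \<open>coer\<close> gives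
      \<open>c + inner v y + norm v \<le> 0\<close>, so only a compact piece of \<open>S\<close>
      needs slack.\<close>
    define R where "R = (c + 1 + norm v) / \<eta>"
    have R: "R \<ge> 0" using c v(2) by (simp add: R_def)
    have cS: "compact (S \<inter> cball 0 R)" using closS by (simp add: closed_Int_compact)
    have cont: "continuous_on (S \<inter> cball 0 R) (\<phi> \<xi>)" unfolding \<phi>_def
      using continuous_on_subset[OF \<delta>(1)] by (intro continuous_intros) (use L in auto)
    obtain y0 where y0: "y0 \<in> S" "\<And>y. y \<in> S \<Longrightarrow> norm y \<le> R \<Longrightarrow> \<phi> \<xi> y \<le> \<phi> \<xi> y0"
      using continuous_attains_sup[OF cS _ cont] zeroS R by fastforce
    have y01: "\<phi> \<xi> y0 < 1" using neg y0(1) \<xi> by (force simp: D_def)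
    \<comment> \<open>Small enough for the least slack of \<xi> on the compact piece, attained at
      \<open>y0\<close>, to absorb the perturbation.\<close>
    define s where "s = min 1 ((1 - \<phi> \<xi> y0) / (c + norm v * R + norm v + 1))"
    have den: "c + norm v * R + norm v + 1 > 0" using c R by (simp add: add_pos_nonneg)
    have s: "s > 0" "s \<le> 1" using y01 den by (auto simp: s_def)
    have "s \<le> (1 - \<phi> \<xi> y0) / (c + norm v * R + norm v + 1)" by (simp add: s_def)
    then have s2: "s * (c + norm v * R + norm v + 1) \<le> 1 - \<phi> \<xi> y0"
      using den by (simp add: pos_le_divide_eq)
    define \<xi>' where "\<xi>' = (1 + s * c) *\<^sub>R \<xi> + s *\<^sub>R v"
    have \<phi>': "\<phi> \<xi>' y \<le> \<phi> \<xi> y + s * (c + inner v y + norm v)" if "y \<in> S" for y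
    proof -
      define q where "q = \<delta> y / L"
      have q: "0 \<le> q" "q \<le> 1" using \<delta>(2,3)[of y] L(1,3) by (auto simp: q_def)
      have "norm \<xi>' \<le> (1 + s * c) * norm \<xi> + s * norm v"
        unfolding \<xi>'_def using norm_triangle_ineq[of "(1 + s * c) *\<^sub>R \<xi>" "s *\<^sub>R v"] s c by simp
      then have "q * norm \<xi>' \<le> q * ((1 + s * c) * norm \<xi> + s * norm v)"
        using q by (intro mult_left_mono)
      moreover have "q * (s * norm v) \<le> 1 * (s * norm v)" using q s by (intro mult_right_mono) auto
      moreover have "(s * c) * \<phi> \<xi> y \<le> (s * c) * 1"
        using \<xi> that s c by (intro mult_left_mono) (auto simp: D_def)
      moreover have \<phi>q: "\<phi> \<zeta> y = inner \<zeta> y + q * norm \<zeta>" for \<zeta> by (simp add: \<phi>_def q_def)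
      moreover have "inner \<xi>' y = (1 + s * c) * inner \<xi> y + s * inner v y"
        by (simp add: \<xi>'_def inner_add_left)
      ultimately show ?thesis by (simp add: algebra_simps)
    qed
    have "\<xi>' \<in> D"
    proof -
      have "\<phi> \<xi>' y \<le> 1" if y: "y \<in> S" for y
      proof (cases "norm y \<le> R")
        case True
        have "inner v y \<le> norm v * norm y" by (rule norm_cauchy_schwarz)
        also have "\<dots> \<le> norm v * R" using True by (intro mult_left_mono) auto
        finally have "s * (c + inner v y + norm v) \<le> s * (c + norm v * R + norm v + 1)"
          using s by (intro mult_left_mono) auto
        then show ?thesis using \<phi>'[OF y] y0(2)[OF y True] s2 by linarith
      next
        case False
        have "\<eta> * R \<le> \<eta> * norm y" using False v(2) by (intro mult_left_mono) auto
        then have "c + 1 + norm v \<le> 1 - inner v y" using coer[OF y] v(2) by (simp add: R_def)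
        then have "s * (c + inner v y + norm v) \<le> 0" using s(1) by (simp add: mult_le_0_iff)
        moreover have "\<phi> \<xi> y \<le> 1" using \<xi> y by (simp add: D_def)
        ultimately show ?thesis using \<phi>'[OF y] by linarith
      qed
      moreover have "\<xi>' \<in> X" using \<xi> v(1) X by (auto simp: \<xi>'_def D_def intro!: subspace_add subspace_scale)
      ultimately show ?thesis by (simp add: D_def)
    qed
    then have "inner \<xi>' x \<le> M" using max by (simp add: M_def)
    moreover have "inner \<xi>' x = M + s * (c * M + inner v x)"
      by (simp add: \<xi>'_def M_def inner_add_left algebra_simps)
    moreover have "c * M = \<bar>inner v x\<bar> + 1" using M by (simp add: c_def)
    ultimately have "s * (\<bar>inner v x\<bar> + 1 + inner v x) \<le> 0" by simp
    then show False using s(1) by (simp add: mult_le_0_iff)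
  qed

  txt \<open>
    The midpoint of two maximizers is tight at some \<open>y \<in> S\<close>, hence both are; off \<open>E\<close> the strict
    convexity of the norm makes them parallel.
  \<close>
  have unique: "\<xi> = \<zeta>" if pos: "minkowski_functional (polar D) x > 0" and \<xi>: "\<xi> \<in> D" and \<zeta>: "\<zeta> \<in> D"
    and e1: "inner \<xi> x = minkowski_functional (polar D) x"
    and e2: "inner \<zeta> x = minkowski_functional (polar D) x" for x \<xi> \<zeta>
  proof -
    define m where "m = (1 / 2) *\<^sub>R \<xi> + (1 / 2) *\<^sub>R \<zeta>"
    have nm: "norm m = norm (\<xi> + \<zeta>) / 2"
      unfolding m_def scaleR_add_right[symmetric] by simp
    \<comment> \<open>The defect of the triangle inequality, by which \<open>\<phi>\<close> at the
      midpoint falls below the average; it must vanish where the midpoint is tight.\<close>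
    define \<kappa> where "\<kappa> = (\<lambda>y. \<delta> y / L * ((norm \<xi> + norm \<zeta> - norm (\<xi> + \<zeta>)) / 2))"
    have \<phi>m: "\<phi> m y = (\<phi> \<xi> y + \<phi> \<zeta> y) / 2 - \<kappa> y" for y
    proof -
      define q where "q = \<delta> y / L"
      have \<phi>q: "\<phi> \<theta> y = inner \<theta> y + q * norm \<theta>" for \<theta> by (simp add: \<phi>_def q_def)
      show ?thesis unfolding \<phi>q nm \<kappa>_def q_def[symmetric]
        by (simp add: m_def inner_add_left field_simps)
    qed
    have \<phi>le: "\<phi> \<xi> y \<le> 1" "\<phi> \<zeta> y \<le> 1" if "y \<in> S" for y using \<xi> \<zeta> that by (auto simp: D_def)
    have nn: "\<kappa> y \<ge> 0" for y
      using \<delta>(2)[of y] L(1) norm_triangle_ineq[of \<xi> \<zeta>] by (simp add: \<kappa>_def)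
    have "\<phi> m y \<le> 1" if "y \<in> S" for y using \<phi>m[of y] \<phi>le[OF that] nn[of y] by argo
    moreover have "m \<in> X" using \<xi> \<zeta> X by (auto simp: m_def D_def intro!: subspace_add subspace_scale)
    ultimately have mD: "m \<in> D" by (simp add: D_def)
    have mx: "inner m x = minkowski_functional (polar D) x" using e1 e2 by (simp add: m_def inner_add_left)
    obtain y where y: "y \<in> S" "\<phi> m y = 1"
    proof -
      have "inner \<theta> x \<le> inner m x" if "\<theta> \<in> D" for \<theta>
        using minkowski_functional_polar_attained(2)[OF compD zeroD that, of x] mx by simp
      then show ?thesis using tight_ex[OF mD, of x] mx pos that by auto
    qed
    have eqs: "\<phi> \<xi> y = 1" "\<phi> \<zeta> y = 1" "\<kappa> y = 0"
      using \<phi>m[of y] \<phi>le[OF y(1)] nn[of y] y(2) by argo+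
    show ?thesis
    proof (cases "y \<in> E")
      case True
      then obtain \<theta> where \<theta>: "\<theta> \<in> K" "inner \<theta> y = 1" using ex1 by blast
      have "inner \<xi> y = 1" "inner \<zeta> y = 1" using eqs \<delta>(4)[of y] True by (auto simp: \<phi>_def)
      then show ?thesis using tight_unique[OF True \<theta> \<xi>] tight_unique[OF True \<theta> \<zeta>] by simp
    next
      case False
      then have "\<delta> y \<noteq> 0" using \<delta>(4) by blast
      then have "norm (\<xi> + \<zeta>) = norm \<xi> + norm \<zeta>" using eqs(3) L(1) by (simp add: \<kappa>_def)
      then have par: "norm \<xi> *\<^sub>R \<zeta> = norm \<zeta> *\<^sub>R \<xi>" by (simp add: norm_triangle_eq)
      have "inner (norm \<xi> *\<^sub>R \<zeta>) x = inner (norm \<zeta> *\<^sub>R \<xi>) x" by (simp only: par)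
      then have "norm \<xi> * inner \<zeta> x = norm \<zeta> * inner \<xi> x" by (simp only: inner_scaleR_left)
      then have "norm \<xi> = norm \<zeta>" using e1 e2 pos by simp
      moreover have "norm \<xi> \<noteq> 0" using e1 pos by auto
      ultimately show ?thesis using par by (metis scaleR_cancel_left)
    qed
  qed
  show ?thesis using that[OF compD zeroD _ KD leD unique] by (auto simp: D_def)
qed

section \<open>Normals of a smooth body and necessity of (2)\<close>

text \<open>By the bipolar theorem \<open>W\<close> is the polar of \<open>D = polar W\<close>. At a
  frontier point some element of \<open>D\<close> is tight, and differentiability leaves only the
  gradient, which serves as \<open>g x\<close>.\<close>

lemma smooth_body_normals:
  assumes W: "convex_body W" "0 \<in> interior W" "body_of_class_C1 W"
  obtains D g where "compact D" "0 \<in> D" "polar D = W"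
    "\<And>x. x \<in> frontier W \<Longrightarrow> g x \<in> D"
    "\<And>x. x \<in> frontier W \<Longrightarrow> inner (g x) x = 1"
    "\<And>x. x \<in> frontier W \<Longrightarrow> outer_normal W x = g x /\<^sub>R norm (g x)"
    "\<And>x \<xi>. \<lbrakk>x \<in> frontier W; \<xi> \<in> D; inner \<xi> x = 1\<rbrakk> \<Longrightarrow> \<xi> = g x"
proof -
  define D where "D = polar W"
  have D: "compact D" "0 \<in> D" using bounded_polar[OF W(2)] closed_polar
    by (auto simp: D_def compact_eq_bounded_closed polar_def)
  have pD: "polar D = W"
    unfolding D_def using W interior_subset by (intro polar_polar) (auto simp: convex_body_def)
  define \<mu> where "\<mu> = minkowski_functional W"
  have fr: "x \<in> frontier W \<longleftrightarrow> \<mu> x = 1" for x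
    using frontier_polar[OF D] by (auto simp: pD \<mu>_def)
  have deriv: "GDERIV \<mu> x :> gradient \<mu> x" if "x \<in> frontier W" for x
  proof -
    obtain G where "\<forall>y\<in>UNIV - \<mu> -` {0}. GDERIV \<mu> y :> G y"
      using W(3) unfolding body_of_class_C1_def C1_on_def \<mu>_def by blast
    then have "GDERIV \<mu> x :> G x" using that fr[of x] by auto
    then show ?thesis using gradient_eq by metis
  qed
  have eq: "\<xi> = gradient \<mu> x" if "x \<in> frontier W" "\<xi> \<in> D" "inner \<xi> x = 1" for x \<xi>
    using GDERIV_minkowski_unique[OF D _ that(2), of x "gradient \<mu> x"] deriv[OF that(1)] fr[of x] that
    by (simp add: pD \<mu>_def)
  have "gradient \<mu> x \<in> D \<and> inner (gradient \<mu> x) x = 1" if x: "x \<in> frontier W" for x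
  proof -
    obtain \<xi> where "\<xi> \<in> D" "inner \<xi> x = 1"
      using minkowski_functional_polar_attained(1)[OF D, of x] fr[of x] x by (auto simp: pD \<mu>_def)
    then show ?thesis using eq[OF x] by blast
  qed
  then show ?thesis using that[OF D pD, of "gradient \<mu>"] eq by (simp add: outer_normal_def \<mu>_def)
qed

text \<open>If the normals stay apart along infinitely many indices, limits of
  \<open>g (z k)\<close>, of \<open>g (x k)\<close> and of the projections of \<open>x k\<close>
  give two functionals tight at one frontier point, which must coincide.\<close>

lemma smooth_body_modulus:
  assumes X: "subspace X" and W: "convex_body W" "0 \<in> interior W" "body_of_class_C1 W"
    and nX: "outer_normal W ` frontier W \<subseteq> X"
    and xz: "range x \<subseteq> frontier W" "range z \<subseteq> frontier W" "bounded (range (\<lambda>k. orth_proj X (x k)))"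
    and lim: "(\<lambda>k. inner (outer_normal W (z k)) (x k - z k)) \<longlonglongrightarrow> 0"
  shows "(\<lambda>k. norm (outer_normal W (z k) - outer_normal W (x k))) \<longlonglongrightarrow> 0"
proof -
  let ?P = "orth_proj X"
  obtain D g where D: "compact D" "0 \<in> D" "polar D = W"
    and g: "\<And>x. x \<in> frontier W \<Longrightarrow> g x \<in> D" "\<And>x. x \<in> frontier W \<Longrightarrow> inner (g x) x = 1"
    "\<And>x. x \<in> frontier W \<Longrightarrow> outer_normal W x = g x /\<^sub>R norm (g x)"
    and uniq: "\<And>x \<xi>. \<lbrakk>x \<in> frontier W; \<xi> \<in> D; inner \<xi> x = 1\<rbrakk> \<Longrightarrow> \<xi> = g x"
    by (rule smooth_body_normals[OF W]) blast
  define \<mu> where "\<mu> = minkowski_functional W"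
  have fr: "x \<in> frontier W \<longleftrightarrow> \<mu> x = 1" for x
    using frontier_polar[OF D(1,2)] by (auto simp: D(3) \<mu>_def)
  have le: "inner \<xi> y \<le> \<mu> y" if "\<xi> \<in> D" for \<xi> y
    using minkowski_functional_polar_attained(2)[OF D(1,2) that] by (simp add: D(3) \<mu>_def)
  have g0: "g y \<noteq> 0" if "y \<in> frontier W" for y using g(2)[OF that] by auto
  have gX: "g y \<in> X" if "y \<in> frontier W" for y
  proof -
    have "norm (g y) *\<^sub>R outer_normal W y \<in> X" using nX that X by (intro subspace_scale) auto
    then show ?thesis using g(3)[OF that] g0[OF that] by simp
  qed
  \<comment> \<open>The functionals \<open>g y\<close> lie in \<open>X\<close> and do not
    distinguish a point from its projection. Scaling the projection to a frontier point
    \<open>q\<close> shows through \<open>g q\<close> that its value \<open>m\<close> is at most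
    1.\<close>
  have Pfr: "?P y \<in> frontier W" if y: "y \<in> frontier W" for y
  proof -
    define m where "m = \<mu> (?P y)"
    have "inner (g y) (?P y) = 1" using orth_proj_orthogonal[OF X gX[OF y]] g(2)[OF y] by simp
    then have m: "m \<ge> 1" using le[OF g(1)[OF y], of "?P y"] by (simp add: m_def)
    define q where "q = (1 / m) *\<^sub>R ?P y"
    have "\<mu> q = 1"
      using minkowski_functional_polar_scale[OF D(1,2), of "1 / m" "?P y"] m
      by (simp add: q_def D(3) \<mu>_def m_def)
    then have q: "q \<in> frontier W" by (simp add: fr)
    have "inner (g q) (?P y) = m" using g(2)[OF q] m by (simp add: q_def)
    then have "inner (g q) y = m" using orth_proj_orthogonal[OF X gX[OF q]] by simp
    then have "m \<le> 1" using le[OF g(1)[OF q], of y] y by (simp add: fr)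
    then show ?thesis using m by (simp add: fr m_def)
  qed
  have xf: "x k \<in> frontier W" and zf: "z k \<in> frontier W" for k using xz by auto
  show ?thesis
  proof (rule ccontr)
    assume "\<not> ?thesis"
    then obtain e where e: "e > 0"
      "\<And>n. \<exists>k\<ge>n. norm (outer_normal W (z k) - outer_normal W (x k)) \<ge> e"
      unfolding LIMSEQ_def by (auto simp: not_less)
    define C where "C = closure (range (\<lambda>k. ?P (x k)))"
    have "compact C" using xz(3) by (simp add: C_def compact_closure)
    then have comp: "compact (D \<times> D \<times> C)" by (intro compact_Times D(1))
    have "\<exists>s. \<forall>n. s n \<ge> n \<and> norm (outer_normal W (z (s n)) - outer_normal W (x (s n))) \<ge> e"
      using e(2) by metis
    then obtain s :: "nat \<Rightarrow> nat" where s: "\<And>n. s n \<ge> n"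
      "\<And>n. norm (outer_normal W (z (s n)) - outer_normal W (x (s n))) \<ge> e" by blast
    define f where "f = (\<lambda>n. (g (z (s n)), g (x (s n)), ?P (x (s n))))"
    have "\<forall>n. f n \<in> D \<times> D \<times> C"
      using g(1) xf zf closure_subset[of "range (\<lambda>k. ?P (x k))"] by (auto simp: f_def C_def)
    then obtain l r where l: "l \<in> D \<times> D \<times> C" "strict_mono r" "(f \<circ> r) \<longlonglongrightarrow> l"
      using comp unfolding compact_def by metis
    obtain a b y where lab: "l = (a, b, y)" by (cases l)
    define t where "t = s \<circ> r"
    have ab: "a \<in> D" "b \<in> D" using l(1) lab by auto
    have tl: "(\<lambda>n. (g (z (t n)), g (x (t n)), ?P (x (t n)))) \<longlonglongrightarrow> (a, b, y)"
      using l(3) by (simp add: lab f_def o_def t_def)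
    have za: "(\<lambda>n. g (z (t n))) \<longlonglongrightarrow> a" using tendsto_fst[OF tl] by simp
    have xb: "(\<lambda>n. g (x (t n))) \<longlonglongrightarrow> b" using tendsto_fst[OF tendsto_snd[OF tl]] by simp
    have xy: "(\<lambda>n. ?P (x (t n))) \<longlonglongrightarrow> y" using tendsto_snd[OF tendsto_snd[OF tl]] by simp
    have y: "y \<in> frontier W"
      using closed_sequentially[OF frontier_closed, of "\<lambda>n. ?P (x (t n))" W y] xy Pfr xf by blast
    \<comment> \<open>\<open>s\<close> need not be increasing, so convergence along \<open>t\<close>
      is drawn from \<open>t n \<ge> n\<close>.\<close>
    have "t n \<ge> n" for n
      using order_trans[OF seq_suble[OF l(2), of n] s(1)[of "r n"]] by (simp add: t_def)
    then have "filterlim t at_top sequentially"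
      by (intro filterlim_at_top_mono[OF filterlim_ident]) simp
    then have lim': "(\<lambda>n. inner (outer_normal W (z (t n))) (x (t n) - z (t n))) \<longlonglongrightarrow> 0"
      using filterlim_compose[OF lim, of t] by simp
    \<comment> \<open>As \<open>g (z k)\<close> lies in \<open>X\<close> and equals 1 at
      \<open>z k\<close>, the assumed limit makes it asymptotically tight at the projection of
      \<open>x k\<close>.\<close>
    have "inner (g (z k)) (?P (x k)) = norm (g (z k)) * inner (outer_normal W (z k)) (x k - z k) + 1" for k
      using g(2)[OF zf[of k]] g(3)[OF zf[of k]] g0[OF zf[of k]] orth_proj_orthogonal[OF X gX[OF zf[of k]], of "x k"]
      by (simp add: inner_diff_right field_simps)
    then have "(\<lambda>n. inner (g (z (t n))) (?P (x (t n)))) \<longlonglongrightarrow> norm a * 0 + 1"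
      using tendsto_add[OF tendsto_mult[OF tendsto_norm[OF za] lim'] tendsto_const[of 1]] by simp
    moreover have "(\<lambda>n. inner (g (z (t n))) (?P (x (t n)))) \<longlonglongrightarrow> inner a y"
      by (intro tendsto_intros za xy)
    ultimately have ay: "inner a y = 1" using LIMSEQ_unique by fastforce
    have "inner (g (x k)) (?P (x k)) = 1" for k
      using g(2)[OF xf[of k]] orth_proj_orthogonal[OF X gX[OF xf[of k]]] by simp
    moreover have "(\<lambda>n. inner (g (x (t n))) (?P (x (t n)))) \<longlonglongrightarrow> inner b y"
      by (intro tendsto_intros xb xy)
    ultimately have "inner b y = 1" by (simp add: LIMSEQ_const_iff)
    then have "a = b" using uniq[OF y ab(1) ay] uniq[OF y ab(2)] by simp
    have a0: "a \<noteq> 0" using ay by auto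
    have "(\<lambda>n. norm (g (z (t n)) /\<^sub>R norm (g (z (t n))) - g (x (t n)) /\<^sub>R norm (g (x (t n)))))
        \<longlonglongrightarrow> norm (a /\<^sub>R norm a - b /\<^sub>R norm b)"
      using a0 \<open>a = b\<close> by (intro tendsto_intros za xb) auto
    then have "(\<lambda>n. norm (outer_normal W (z (t n)) - outer_normal W (x (t n)))) \<longlonglongrightarrow> 0"
      using g(3)[OF zf] g(3)[OF xf] \<open>a = b\<close> by simp
    then have "e \<le> 0"
      by (rule LIMSEQ_le_const) (use s(2) in \<open>auto simp: t_def intro!: exI[of _ 0]\<close>)
    then show False using e(1) by simp
  qed
qed

section \<open>Cones and spanning functionals\<close>

text \<open>The extra element \<open>1 / 2\<close> keeps \<epsilon> below 1 and covers empty
  \<open>J\<close>.\<close>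

lemma finite_positive_lower_bound:
  fixes c :: "'b \<Rightarrow> real"
  assumes "finite J" "\<And>j. j \<in> J \<Longrightarrow> c j > 0"
  obtains \<epsilon> where "0 < \<epsilon>" "\<epsilon> < 1" "\<And>j. j \<in> J \<Longrightarrow> \<epsilon> \<le> c j"
proof (rule that[of "Min (insert (1 / 2) (c ` J))"])
  show "0 < Min (insert (1 / 2) (c ` J))" using assms by (subst Min_gr_iff) auto
  have "Min (insert (1 / 2) (c ` J)) \<le> 1 / 2" using assms by (intro Min_le) auto
  then show "Min (insert (1 / 2) (c ` J)) < 1" by simp
  show "Min (insert (1 / 2) (c ` J)) \<le> c j" if "j \<in> J" for j using assms that by (intro Min_le) auto
qed

lemma dim_orthogonal_complement_within:
  fixes X Y :: "'a::euclidean_space set"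
  assumes "subspace X" "subspace Y" "Y \<subseteq> X"
  shows "dim {z \<in> X. \<forall>y\<in>Y. orthogonal z y} = dim X - dim Y"
  using dim_subspace_orthogonal_to_vectors[OF assms(2,1,3)] by (simp add: orthogonal_commute)

text \<open>The components of the normals orthogonal to \<open>Y\<close> contain a basis of the
  complement of \<open>Y\<close> in \<open>X\<close>, coming from points \<open>q j\<close>. The
  cone at \<open>2 *\<^sub>R q j\<close> around such a component lies where \<open>n (q j)\<close>
  is at least twice its value at \<open>q j\<close>, whereas on \<open>C\<close> it is at most that
  value.\<close>

lemma disjoint_cones:
  fixes X Y :: "'a::euclidean_space set"
  assumes X: "X = span (n ` B)" and Y: "subspace Y" "Y \<subseteq> X"
    and le: "\<And>x q. \<lbrakk>x \<in> C; q \<in> B\<rbrakk> \<Longrightarrow> inner (n q) x \<le> inner (n q) q"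
    and pos: "\<And>q. q \<in> B \<Longrightarrow> inner (n q) q > 0"
  shows "\<exists>(w :: nat \<Rightarrow> 'a) (p :: nat \<Rightarrow> 'a) (\<epsilon> :: real).
      0 < \<epsilon> \<and> \<epsilon> < 1 \<and>
      inj_on w {1..dim X - dim Y} \<and> independent (w ` {1..dim X - dim Y}) \<and>
      (\<forall>j\<in>{1..dim X - dim Y}. w j \<in> X \<and> (\<forall>y\<in>Y. orthogonal (w j) y) \<and> norm (w j) = 1) \<and>
      C \<inter> (\<Union>j\<in>{1..dim X - dim Y}. {x. \<epsilon> * inner (w j) (x - p j) \<ge> norm (orth_proj Y (x - p j))}) = {}"
proof -
  let ?P = "orth_proj Y" and ?k = "dim X - dim Y"
  let ?Z = "{z \<in> X. \<forall>y\<in>Y. orthogonal z y}"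
  define Q where "Q = (\<lambda>v. v - ?P v)"
  have sX: "subspace X" unfolding X by (rule subspace_span)
  have linQ: "linear Q" unfolding Q_def
    by (intro linear_compose_sub linear_ident linear_orth_proj Y(1))
  have QX: "Q ` X = ?Z"
  proof (intro equalityI subsetI)
    fix u assume "u \<in> Q ` X"
    then obtain x where x: "x \<in> X" "u = x - ?P x" by (auto simp: Q_def)
    have "orthogonal u y" if "y \<in> Y" for y
      using orth_proj_orthogonal[OF Y(1) that, of x] x(2)
      by (simp add: orthogonal_def inner_diff_right inner_commute[of _ y])
    moreover have "u \<in> X" using x orth_proj_in[OF Y(1), of x] Y(2) sX by (auto intro: subspace_diff)
    ultimately show "u \<in> ?Z" by blast
  next
    fix u assume u: "u \<in> ?Z"
    have "?P u = 0"
      using u Y(1) by (intro orth_proj_unique) (auto simp: subspace_0 orthogonal_def inner_commute)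
    then have "u = Q u" by (simp add: Q_def)
    then show "u \<in> Q ` X" using u by blast
  qed
  have spQ: "span (Q ` n ` B) = ?Z" using QX linear_span_image[OF linQ, of "n ` B"] X by simp
  have dimQ: "dim (Q ` n ` B) = ?k"
    using dim_orthogonal_complement_within[OF sX Y] spQ dim_span[of "Q ` n ` B"] by simp
  obtain Bs where Bs: "Bs \<subseteq> Q ` n ` B" "independent Bs" "card Bs = ?k"
    using basis_exists[of "Q ` n ` B"] dimQ by metis
  have "finite Bs" using Bs(2) by (rule finiteI_independent)
  then obtain u where u: "bij_betw u {1..?k} Bs"
    using ex_bij_betw_nat_finite_1 Bs(3) by metis
  have uBs: "u j \<in> Bs" if "j \<in> {1..?k}" for j using u that by (auto simp: bij_betw_def)
  then have "\<forall>j\<in>{1..?k}. \<exists>q. q \<in> B \<and> u j = Q (n q)" using Bs(1) by blast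
  then obtain q where q: "\<And>j. j \<in> {1..?k} \<Longrightarrow> q j \<in> B" "\<And>j. j \<in> {1..?k} \<Longrightarrow> u j = Q (n (q j))"
    by metis
  have u0: "u j \<noteq> 0" if "j \<in> {1..?k}" for j using uBs[OF that] Bs(2) dependent_zero by metis
  define w where "w = (\<lambda>j. u j /\<^sub>R norm (u j))"
  \<comment> \<open>Independence and injectivity of \<open>w\<close> come from counting: its at most
    \<open>?k\<close> values span a space of dimension at least \<open>?k\<close>.\<close>
  have "u j \<in> span (w ` {1..?k})" if "j \<in> {1..?k}" for j
  proof -
    have "u j = norm (u j) *\<^sub>R w j" using u0[OF that] by (simp add: w_def)
    then show ?thesis using that by (metis imageI span_base span_scale)
  qed
  then have "Bs \<subseteq> span (w ` {1..?k})" using u by (auto simp: bij_betw_def)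
  then have "?k \<le> dim (w ` {1..?k})"
    using dim_subset[of Bs "span (w ` {1..?k})"] dim_eq_card_independent[OF Bs(2)] Bs(3) by simp
  moreover have cw: "card (w ` {1..?k}) \<le> ?k" using card_image_le[of "{1..?k}" w] by simp
  ultimately have dw: "card (w ` {1..?k}) \<le> dim (w ` {1..?k})" by simp
  have indw: "independent (w ` {1..?k})"
    by (rule card_le_dim_spanning[OF order_refl span_superset _ dw]) simp
  have "card (w ` {1..?k}) = ?k"
    using cw \<open>?k \<le> dim (w ` {1..?k})\<close> dim_eq_card_independent[OF indw] by simp
  then have injw: "inj_on w {1..?k}" by (intro eq_card_imp_inj_on) auto
  have wZ: "w j \<in> ?Z \<and> norm (w j) = 1" if "j \<in> {1..?k}" for j
  proof -
    have "u j \<in> ?Z" using uBs[OF that] Bs(1) spQ span_superset[of "Q ` n ` B"] by blast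
    then show ?thesis using u0[OF that] sX
      by (auto simp: w_def subspace_scale orthogonal_def)
  qed
  \<comment> \<open>The cones are narrow enough that \<epsilon> times the norm of the
    \<open>Y\<close>-component of each chosen normal is at most the norm of its orthogonal
    component; the summand 1 avoids division by 0.\<close>
  obtain \<epsilon> where \<epsilon>: "0 < \<epsilon>" "\<epsilon> < 1"
    "\<And>j. j \<in> {1..?k} \<Longrightarrow> \<epsilon> \<le> norm (u j) / (norm (?P (n (q j))) + 1)"
    using finite_positive_lower_bound[of "{1..?k}" "\<lambda>j. norm (u j) / (norm (?P (n (q j))) + 1)"] u0
    by (auto simp: add_nonneg_pos)
  define p where "p = (\<lambda>j. 2 *\<^sub>R q j)"
  have "C \<inter> (\<Union>j\<in>{1..?k}. {x. \<epsilon> * inner (w j) (x - p j) \<ge> norm (?P (x - p j))}) = {}"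
  proof (rule ccontr)
    assume "\<not> ?thesis"
    then obtain x j where x: "x \<in> C" and j: "j \<in> {1..?k}"
      and V: "\<epsilon> * inner (w j) (x - p j) \<ge> norm (?P (x - p j))" by blast
    define a t \<nu> where "a = ?P (n (q j))" and "t = inner (w j) (x - p j)" and "\<nu> = n (q j)"
    have "\<epsilon> * t \<ge> 0" using V norm_ge_zero order_trans unfolding t_def by blast
    then have t: "t \<ge> 0" using \<epsilon>(1) by (simp add: zero_le_mult_iff)
    have "\<epsilon> * (norm a + 1) \<le> norm (u j)"
      using \<epsilon>(3)[OF j] by (simp add: a_def pos_le_divide_eq add_nonneg_pos)
    then have ea: "\<epsilon> * norm a \<le> norm (u j)" using \<epsilon>(1) by (simp add: distrib_left)
    have aY: "a \<in> Y" using orth_proj_in[OF Y(1)] by (simp add: a_def)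
    have \<nu>: "\<nu> = a + norm (u j) *\<^sub>R w j" using q(2)[OF j] u0[OF j] by (simp add: w_def Q_def a_def \<nu>_def)
    \<comment> \<open>On the cone the part of the normal along \<open>w j\<close> dominates its part
      \<open>a\<close> in \<open>Y\<close>.\<close>
    have "- inner a (x - p j) = inner (- a) (?P (x - p j))"
      using orth_proj_orthogonal[OF Y(1) aY] by simp
    also have "\<dots> \<le> norm (- a) * norm (?P (x - p j))" by (rule norm_cauchy_schwarz)
    also have "\<dots> \<le> norm a * (\<epsilon> * t)" using V by (simp add: t_def mult_left_mono)
    also have "\<dots> = (\<epsilon> * norm a) * t" by simp
    also have "\<dots> \<le> norm (u j) * t" using ea t by (rule mult_right_mono)
    finally have "inner \<nu> (x - p j) \<ge> 0" unfolding \<nu> t_def by (simp add: inner_add_left)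
    then have "inner \<nu> x \<ge> 2 * inner \<nu> (q j)" by (simp add: p_def inner_diff_right)
    then show False using le[OF x q(1)[OF j]] pos[OF q(1)[OF j]] by (simp add: \<nu>_def)
  qed
  then show ?thesis using \<epsilon>(1,2) injw indw wZ by blast
qed

text \<open>Off the cone, \<open>\<epsilon> * inner (w j) x\<close> is below the norm of the
  projection of \<open>x\<close> plus a constant, and \<open>coercive_polar\<close> bounds that norm
  by an affine function of \<open>inner v x\<close>. So \<open>u j\<close> is bounded above on
  \<open>E\<close>, and since \<open>v\<close> lies in \<open>span K\<close>, the vector
  \<open>w j\<close> can be recovered from it.\<close>

lemma spanning_functionals_of_cones:
  fixes X E K :: "'a::euclidean_space set" and w p :: "nat \<Rightarrow> 'a"
  assumes X: "subspace X" and K: "K \<subseteq> X" "E \<subseteq> polar K"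
    and \<epsilon>: "\<epsilon> > 0"
    and w: "inj_on w {1..dim X - dim (span K)}" "independent (w ` {1..dim X - dim (span K)})"
      "\<And>j. j \<in> {1..dim X - dim (span K)} \<Longrightarrow> w j \<in> X \<and> (\<forall>y\<in>span K. orthogonal (w j) y)"
    and V: "\<And>j x. \<lbrakk>j \<in> {1..dim X - dim (span K)}; x \<in> insert 0 E\<rbrakk>
      \<Longrightarrow> \<epsilon> * inner (w j) (x - p j) < norm (orth_proj (span K) (x - p j))"
  obtains F where "finite F" "F \<subseteq> X" "span (K \<union> F) = X" "\<And>f x. \<lbrakk>f \<in> F; x \<in> E\<rbrakk> \<Longrightarrow> inner f x \<le> 1 / 2"
proof -
  let ?Y = "span K" and ?k = "dim X - dim (span K)"
  let ?P = "orth_proj ?Y"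
  have YX: "?Y \<subseteq> X" using K(1) X by (rule span_minimal)
  obtain v \<eta> where v: "v \<in> ?Y" "\<eta> > 0" "\<And>x. x \<in> polar K \<Longrightarrow> \<eta> * norm (?P x) \<le> 1 - inner v x"
    using coercive_polar[of K] by blast
  define c where "c = (\<lambda>j. 1 / \<eta> + norm (?P (p j)) + \<epsilon> * inner (w j) (p j))"
  define u where "u = (\<lambda>j. \<epsilon> *\<^sub>R w j + (1 / \<eta>) *\<^sub>R v)"
  define f where "f = (\<lambda>j. (1 / (2 * c j)) *\<^sub>R u j)"
  have Pdiff: "norm (?P (x - p j)) \<le> norm (?P x) + norm (?P (p j))" for x j
    using linear_diff[OF linear_orth_proj[OF subspace_span[of K]], of x "p j"]
    by (simp add: norm_triangle_ineq4)
  have ux: "inner (u j) x < c j" if j: "j \<in> {1..?k}" and x: "x \<in> insert 0 E" for j x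
  proof -
    have "x \<in> polar K" using x K(2) by (auto simp: polar_def)
    then have "norm (?P x) \<le> 1 / \<eta> - (1 / \<eta>) * inner v x"
      using v(3)[of x] v(2) by (simp add: field_simps)
    moreover have "\<epsilon> * inner (w j) x - \<epsilon> * inner (w j) (p j) < norm (?P x) + norm (?P (p j))"
      using V[OF j x] Pdiff[of x j] by (simp add: inner_diff_right right_diff_distrib)
    ultimately show ?thesis by (simp add: u_def c_def inner_add_left)
  qed
  \<comment> \<open>This is why the cones must miss 0: the upper bound of \<open>u j\<close> is
    positive, so \<open>u j\<close> can be rescaled to have bound \<open>1 / 2\<close>, which keeps
    it from being tight on \<open>E\<close>.\<close>
  have c: "c j > 0" if "j \<in> {1..?k}" for j using ux[OF that, of 0] by simp
  have fle: "inner (f j) x \<le> 1 / 2" if j: "j \<in> {1..?k}" and x: "x \<in> E" for j x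
    using ux[OF j, of x] c[OF j] x by (simp add: f_def field_simps)
  have fX: "f j \<in> X" if "j \<in> {1..?k}" for j
    unfolding f_def u_def using w(3)[OF that] v(1) YX X by (auto intro!: subspace_scale subspace_add)
  let ?S = "span (K \<union> f ` {1..?k})"
  have "?S = X"
  proof
    show "?S \<subseteq> X" using K(1) fX X by (intro span_minimal) auto
    have YS: "?Y \<subseteq> ?S" by (intro span_mono) auto
    have wS: "w j \<in> ?S" if "j \<in> {1..?k}" for j
    proof -
      have "f j \<in> ?S" using that by (intro span_base) auto
      then have "(1 / \<epsilon>) *\<^sub>R ((2 * c j) *\<^sub>R f j - (1 / \<eta>) *\<^sub>R v) \<in> ?S"
        using v(1) YS by (auto intro!: span_scale span_diff)
      moreover have "(1 / \<epsilon>) *\<^sub>R ((2 * c j) *\<^sub>R f j - (1 / \<eta>) *\<^sub>R v) = w j"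
        using c[OF that] \<epsilon> by (simp add: f_def u_def)
      ultimately show ?thesis by simp
    qed
    let ?Z = "{z \<in> X. \<forall>y\<in>?Y. orthogonal z y}"
    \<comment> \<open>The \<open>w j\<close> are independent and as many as the dimension of the
      complement, so they span it.\<close>
    have "?Z \<subseteq> span (w ` {1..?k})"
      using w card_image[OF w(1)] dim_orthogonal_complement_within[OF X subspace_span YX]
      by (intro card_ge_dim_independent) auto
    also have "\<dots> \<subseteq> ?S" using wS by (intro span_minimal) auto
    finally have ZS: "?Z \<subseteq> ?S" .
    show "X \<subseteq> ?S"
    proof
      fix x assume x: "x \<in> X"
      have P: "?P x \<in> ?Y" by (simp add: orth_proj_in)
      have "inner (x - ?P x) y = 0" if "y \<in> ?Y" for y
        using orth_proj_orthogonal[OF subspace_span that, of x] by (simp add: inner_commute[of _ y] inner_diff_right)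
      then have "x - ?P x \<in> ?Z" using x P YX X by (auto simp: orthogonal_def intro: subspace_diff)
      then have "?P x + (x - ?P x) \<in> ?S" using P YS ZS by (intro span_add) auto
      then show "x \<in> ?S" by simp
    qed
  qed
  then show ?thesis using fX fle by (intro that[of "f ` {1..?k}"]) blast+
qed

section \<open>Construction of the body\<close>

text \<open>Condition (2) in dual form. If \<open>G (z k)\<close> tends to \<xi>, tightness at
  \<open>x\<close> makes \<open>inner (N (z k)) (e k - z k)\<close> tend to 0, so
  \<open>N (e k)\<close> and \<open>N (z k)\<close> share a limit, and renormalizing carries this
  over to \<open>G\<close>. As the sequence \<open>e\<close> determines the limit, at most one such
  \<xi> is tight at \<open>x\<close>.\<close>

lemma tight_limit:
  fixes E X :: "'a::euclidean_space set" and N :: "'a \<Rightarrow> 'a"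
  defines "G \<equiv> \<lambda>x. N x /\<^sub>R inner (N x) x"
  assumes X: "subspace X" and NX: "N ` E \<subseteq> X" and N1: "N ` E \<subseteq> sphere 0 1"
    and pos: "\<And>y. y \<in> E \<Longrightarrow> inner (N y) y > 0"
    and modulus: "\<And>x z :: nat \<Rightarrow> 'a. \<lbrakk>range x \<subseteq> E; range z \<subseteq> E; bounded (range (\<lambda>k. orth_proj X (x k)));
      (\<lambda>k. inner (N (z k)) (x k - z k)) \<longlonglongrightarrow> 0\<rbrakk> \<Longrightarrow> (\<lambda>k. norm (N (z k) - N (x k))) \<longlonglongrightarrow> 0"
    and e: "range e \<subseteq> E" "(\<lambda>k. orth_proj X (e k)) \<longlonglongrightarrow> x"
    and \<xi>: "\<xi> \<in> closure (G ` E)" "inner \<xi> x = 1"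
  shows "(\<lambda>k. G (e k)) \<longlonglongrightarrow> \<xi>"
proof -
  let ?P = "orth_proj X"
  have \<xi>0: "\<xi> \<noteq> 0" using \<xi>(2) by auto
  obtain s where s: "\<And>k. s k \<in> G ` E" "s \<longlonglongrightarrow> \<xi>" using \<xi>(1) by (auto simp: closure_sequential)
  then have "\<forall>k. \<exists>z. z \<in> E \<and> s k = G z" by blast
  then obtain z where z: "\<And>k. z k \<in> E" "\<And>k. s k = G (z k)" by metis
  have Gz: "(\<lambda>k. G (z k)) \<longlonglongrightarrow> \<xi>" using s(2) unfolding z(2)[symmetric] by simp
  have eE: "e k \<in> E" for k using e(1) by auto
  have NG: "inner (N y) y = 1 / norm (G y)" "N y = G y /\<^sub>R norm (G y)" if "y \<in> E" for y
  proof -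
    have "norm (N y) = 1" using N1 that by auto
    then show "inner (N y) y = 1 / norm (G y)" "N y = G y /\<^sub>R norm (G y)"
      using pos[OF that] by (auto simp: G_def divide_simps)
  qed
  have NP: "inner (N y) (?P y') = inner (N y) y'" if "y \<in> E" for y y'
    using orth_proj_orthogonal[OF X, of "N y" y'] NX that by auto
  have "inner (N (z k)) (e k - z k) = inner (G (z k) /\<^sub>R norm (G (z k))) (?P (e k)) - 1 / norm (G (z k))" for k
    using NG[OF z(1)[of k]] NP[OF z(1)[of k], of "e k"] by (simp only: inner_diff_right)
  moreover have "(\<lambda>k. inner (G (z k) /\<^sub>R norm (G (z k))) (?P (e k)) - 1 / norm (G (z k)))
      \<longlonglongrightarrow> inner (\<xi> /\<^sub>R norm \<xi>) x - 1 / norm \<xi>"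
    using \<xi>0 by (intro tendsto_intros Gz e(2)) auto
  moreover have "inner (\<xi> /\<^sub>R norm \<xi>) x - 1 / norm \<xi> = 0" using \<xi>(2) by (simp add: divide_inverse)
  ultimately have "(\<lambda>k. inner (N (z k)) (e k - z k)) \<longlonglongrightarrow> 0" by simp
  moreover have "bounded (range (\<lambda>k. ?P (e k)))" using convergent_imp_bounded[OF e(2)] .
  ultimately have Nze: "(\<lambda>k. N (z k) - N (e k)) \<longlonglongrightarrow> 0"
    using modulus[OF e(1), of z] z(1) tendsto_norm_zero_iff by blast
  have "(\<lambda>k. G (z k) /\<^sub>R norm (G (z k))) \<longlonglongrightarrow> \<xi> /\<^sub>R norm \<xi>"
    using \<xi>0 by (intro tendsto_intros Gz) auto
  then have "(\<lambda>k. N (z k)) \<longlonglongrightarrow> \<xi> /\<^sub>R norm \<xi>" using NG(2)[OF z(1)] by simp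
  from tendsto_diff[OF this Nze] have Ne: "(\<lambda>k. N (e k)) \<longlonglongrightarrow> \<xi> /\<^sub>R norm \<xi>" by simp
  \<comment> \<open>The denominators tend to \<open>1 / norm \<xi>\<close>, which is not 0.\<close>
  have "(\<lambda>k. N (e k) /\<^sub>R inner (N (e k)) (?P (e k))) \<longlonglongrightarrow> (\<xi> /\<^sub>R norm \<xi>) /\<^sub>R inner (\<xi> /\<^sub>R norm \<xi>) x"
    using \<xi>0 \<xi>(2) by (intro tendsto_intros Ne e(2)) auto
  then show ?thesis using NP[OF eE] \<xi>0 \<xi>(2) by (simp add: G_def)
qed

text \<open>Functionals in \<open>X\<close> see a point only through its projection, so the
  enlargement is applied to \<open>E'\<close>, the closure of the projections, in place of
  \<open>E\<close>.\<close>

lemma smooth_body_exists: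
  fixes E X :: "'a::euclidean_space set" and N :: "'a \<Rightarrow> 'a"
  defines "G \<equiv> \<lambda>x. N x /\<^sub>R inner (N x) x"
  assumes X: "subspace X" and NX: "N ` E \<subseteq> X" and N1: "N ` E \<subseteq> sphere 0 1"
    and mono: "\<And>x y. \<lbrakk>x \<in> E; y \<in> E\<rbrakk> \<Longrightarrow> inner (N y) (x - y) \<le> 0"
    and c: "c > 0" "\<And>y. y \<in> E \<Longrightarrow> c \<le> inner (N y) y"
    and modulus: "\<And>x z :: nat \<Rightarrow> 'a. \<lbrakk>range x \<subseteq> E; range z \<subseteq> E; bounded (range (\<lambda>k. orth_proj X (x k)));
      (\<lambda>k. inner (N (z k)) (x k - z k)) \<longlonglongrightarrow> 0\<rbrakk> \<Longrightarrow> (\<lambda>k. norm (N (z k) - N (x k))) \<longlonglongrightarrow> 0"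
    and F: "finite F" "F \<subseteq> X" "span (G ` E \<union> F) = X" "\<And>f x. \<lbrakk>f \<in> F; x \<in> E\<rbrakk> \<Longrightarrow> inner f x \<le> 1 / 2"
  shows "\<exists>W. convex_body W \<and> 0 \<in> interior W \<and> body_of_class_C1 W \<and> E \<subseteq> frontier W \<and>
              (\<forall>x\<in>E. N x = outer_normal W x) \<and> X = span (outer_normal W ` frontier W)"
proof -
  let ?P = "orth_proj X"
  have pos: "inner (N y) y > 0" if "y \<in> E" for y using c(1) c(2)[OF that] by linarith
  have GX: "G ` E \<subseteq> X" using NX X by (auto simp: G_def subspace_scale)
  have G1: "inner (G y) y = 1" if "y \<in> E" for y using pos[OF that] by (simp add: G_def)
  have Gle: "inner (G y) x \<le> 1" if "y \<in> E" "x \<in> E" for x y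
    using mono[OF that(2,1)] pos[OF that(1)] by (simp add: G_def inner_diff_right field_simps)
  have Gb: "norm (G y) \<le> 1 / c" if "y \<in> E" for y
  proof -
    have "norm (G y) = 1 / inner (N y) y" using N1 that pos[OF that] by (auto simp: G_def divide_simps)
    also have "\<dots> \<le> 1 / c" using c(1) c(2)[OF that] by (intro divide_left_mono mult_pos_pos) auto
    finally show ?thesis .
  qed
  have innerP: "inner \<xi> (?P x) = inner \<xi> x" if "\<xi> \<in> X" for \<xi> x using orth_proj_orthogonal[OF X that] .
  define K where "K = closure (G ` E) \<union> F"
  define E' where "E' = closure (?P ` E)"
  have "bounded (G ` E)" using Gb by (auto simp: bounded_iff)
  then have compK: "compact K" using F(1) by (auto simp: K_def compact_closure intro: compact_Un finite_imp_compact)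
  have KX: "K \<subseteq> X" using closure_minimal[OF GX closed_subspace[OF X]] F(2) by (auto simp: K_def)
  have spK: "span K = X"
  proof
    show "span K \<subseteq> X" using KX X by (rule span_minimal)
    have "G ` E \<union> F \<subseteq> K" using closure_subset[of "G ` E"] unfolding K_def by blast
    then show "X \<subseteq> span K" using F(3) span_mono by blast
  qed
  have E'X: "E' \<subseteq> X" unfolding E'_def
    using closed_subspace[OF X] orth_proj_in[OF X] by (intro closure_minimal) auto
  have leE': "inner \<xi> x \<le> b" if "\<xi> \<in> X" "\<And>y. y \<in> E \<Longrightarrow> inner \<xi> y \<le> b" "x \<in> E'" for \<xi> x b
  proof -
    have "E' \<subseteq> {x. inner \<xi> x \<le> b}" unfolding E'_def
      using that(1,2) by (intro closure_minimal closed_halfspace_le) (auto simp: innerP)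
    then show ?thesis using that(3) by blast
  qed
  have leF: "inner f x \<le> 1 / 2" if "f \<in> F" "x \<in> E'" for f x
    using leE'[of f "1 / 2" x] F(2,4) that by blast
  have leK: "inner \<xi> x \<le> 1" if "\<xi> \<in> K" "x \<in> E'" for \<xi> x
  proof (cases "\<xi> \<in> F")
    case True
    then show ?thesis using leF[OF True that(2)] by simp
  next
    case False
    have "closure (G ` E) \<subseteq> {\<xi>. inner x \<xi> \<le> 1}"
    proof (intro closure_minimal closed_halfspace_le subsetI)
      fix \<zeta> assume "\<zeta> \<in> G ` E"
      then show "\<zeta> \<in> {\<xi>. inner x \<xi> \<le> 1}"
        using leE'[of \<zeta> 1 x] Gle GX that(2) by (auto simp: inner_commute)
    qed
    then show ?thesis using False that(1) by (auto simp: K_def inner_commute)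
  qed
  have tight: "(\<lambda>k. G (e k)) \<longlonglongrightarrow> \<xi>"
    if "range e \<subseteq> E" "(\<lambda>k. ?P (e k)) \<longlonglongrightarrow> x" "\<xi> \<in> closure (G ` E)" "inner \<xi> x = 1" for e x \<xi>
    using tight_limit[OF X NX N1 pos modulus that(1,2)] that(3,4) unfolding G_def by blast
  \<comment> \<open>Existence: a subsequential limit of \<open>G (e k)\<close>, where the
    projections of \<open>e k\<close> tend to \<open>x\<close>. Uniqueness: members of
    \<open>F\<close> stay below 1, and \<open>tight\<close> makes every other candidate a limit of
    the same sequence.\<close>
  have ex1: "\<exists>!\<xi>. \<xi> \<in> K \<and> inner \<xi> x = 1" if x: "x \<in> E'" for x
  proof -
    obtain s where s: "\<And>k. s k \<in> ?P ` E" "s \<longlonglongrightarrow> x" using x by (auto simp: E'_def closure_sequential)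
    then have "\<forall>k. \<exists>y. y \<in> E \<and> s k = ?P y" by blast
    then obtain e where e: "\<And>k. e k \<in> E" "\<And>k. s k = ?P (e k)" by metis
    have lim: "(\<lambda>k. ?P (e k)) \<longlonglongrightarrow> x" using s(2) unfolding e(2)[symmetric] by simp
    have rE: "range e \<subseteq> E" using e(1) by auto
    have comp: "compact (closure (G ` E))" using \<open>bounded (G ` E)\<close> by (simp add: compact_closure)
    have "\<forall>k. G (e k) \<in> closure (G ` E)" using e(1) closure_subset by blast
    then obtain \<xi> r where \<xi>: "\<xi> \<in> closure (G ` E)" "strict_mono r" "((\<lambda>k. G (e k)) \<circ> r) \<longlonglongrightarrow> \<xi>"
      using comp unfolding compact_def by metis
    have "(\<lambda>k. inner (G (e (r k))) (?P (e (r k)))) \<longlonglongrightarrow> inner \<xi> x"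
      using \<xi>(3) LIMSEQ_subseq_LIMSEQ[OF lim \<xi>(2)] by (intro tendsto_inner) (auto simp: o_def)
    moreover have "inner (G (e k)) (?P (e k)) = 1" for k
      using innerP[of "G (e k)" "e k"] GX e(1)[of k] G1[OF e(1)[of k]] by auto
    ultimately have \<xi>x: "inner \<xi> x = 1" by (simp add: LIMSEQ_const_iff)
    show ?thesis
    proof (intro ex1I[of _ \<xi>] conjI)
      show "\<xi> \<in> K" using \<xi>(1) by (simp add: K_def)
      show "inner \<xi> x = 1" by fact
      fix \<zeta> assume \<zeta>: "\<zeta> \<in> K \<and> inner \<zeta> x = 1"
      then have "\<zeta> \<notin> F" using leF[of \<zeta> x] x by auto
      then have "\<zeta> \<in> closure (G ` E)" using \<zeta> by (simp add: K_def)
      then show "\<zeta> = \<xi>" using tight[OF rE lim] \<zeta> \<xi>(1) \<xi>x LIMSEQ_unique by blast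
    qed
  qed
  have clE': "closed E'" by (simp add: E'_def)
  obtain D where D: "compact D" "0 \<in> D" "D \<subseteq> X" "K \<subseteq> D"
    and leD: "\<And>\<xi> x. \<lbrakk>\<xi> \<in> D; x \<in> E'\<rbrakk> \<Longrightarrow> inner \<xi> x \<le> 1"
    and uniq: "\<And>x \<xi> \<zeta>. \<lbrakk>minkowski_functional (polar D) x > 0; \<xi> \<in> D; \<zeta> \<in> D;
      inner \<xi> x = minkowski_functional (polar D) x;
      inner \<zeta> x = minkowski_functional (polar D) x\<rbrakk> \<Longrightarrow> \<xi> = \<zeta>"
    by (rule enlarge_to_unique_maximizers[OF X compK spK clE' E'X leK ex1]) blast+
  define W where "W = polar D"
  define \<mu> where "\<mu> = minkowski_functional W"
  have fr: "x \<in> frontier W \<longleftrightarrow> \<mu> x = 1" for x using frontier_polar[OF D(1,2)] by (auto simp: \<mu>_def W_def)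
  have grad: "outer_normal W x = \<xi> /\<^sub>R norm \<xi>" if "\<xi> \<in> D" "inner \<xi> x = 1" "x \<in> frontier W" for x \<xi>
  proof -
    have "GDERIV \<mu> x :> \<xi>" unfolding \<mu>_def W_def
    proof (rule polar_body_of_class_C1(2)[OF D(1,2)])
      show "minkowski_functional (polar D) x > 0" "\<xi> \<in> D" "inner \<xi> x = minkowski_functional (polar D) x"
        using that fr[of x] by (auto simp: \<mu>_def W_def)
    qed (rule uniq)
    then show ?thesis using gradient_eq[of \<mu> x \<xi>] by (simp add: outer_normal_def \<mu>_def)
  qed
  have E\<mu>: "G x \<in> D \<and> x \<in> frontier W" if x: "x \<in> E" for x
  proof -
    have GD: "G x \<in> D" using x closure_subset[of "G ` E"] D(4) by (auto simp: K_def)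
    have "?P x \<in> E'" using x closure_subset[of "?P ` E"] by (auto simp: E'_def)
    then have "inner \<xi> x \<le> 1" if "\<xi> \<in> D" for \<xi>
      using leD[OF that, of "?P x"] innerP[of \<xi> x] that D(3) by auto
    then have "\<mu> x = 1" unfolding \<mu>_def W_def
      using GD G1[OF x] by (intro minkowski_functional_polar D(2)) auto
    then show ?thesis using GD fr by blast
  qed
  have NW: "N x = outer_normal W x" if x: "x \<in> E" for x
  proof -
    have "norm (N x) = 1" using N1 x by auto
    then have "N x = G x /\<^sub>R norm (G x)" using pos[OF x] by (simp add: G_def)
    then show ?thesis using grad[of "G x" x] E\<mu>[OF x] G1[OF x] by simp
  qed
  let ?S = "span (outer_normal W ` frontier W)"
  have att: "\<exists>\<xi>\<in>D. inner \<xi> x = \<mu> x" for x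
    using minkowski_functional_polar_attained(1)[OF D(1,2)] by (simp add: \<mu>_def W_def)
  have SX: "?S \<subseteq> X"
  proof (intro span_minimal X subsetI)
    fix \<nu> assume "\<nu> \<in> outer_normal W ` frontier W"
    then obtain x where x: "x \<in> frontier W" "\<nu> = outer_normal W x" by blast
    obtain \<xi> where "\<xi> \<in> D" "inner \<xi> x = 1" using att[of x] x(1) fr by auto
    then show "\<nu> \<in> X" using grad[of \<xi> x] x D(3) X by (auto intro: subspace_scale)
  qed
  \<comment> \<open>Let \<open>h\<close> be the component orthogonal to all normals. A positive
    value of \<mu> on the line through \<open>h\<close> would, after scaling, give a frontier point
    whose normal is not orthogonal to \<open>h\<close>. So \<mu> is at most 0 on that line, every
    element of \<open>K\<close> vanishes at \<open>h\<close>, and \<open>K\<close> spans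
    \<open>X\<close>.\<close>
  have XS: "X \<subseteq> ?S"
  proof
    fix x assume x: "x \<in> X"
    define h where "h = x - orth_proj ?S x"
    have hX: "h \<in> X" using x orth_proj_in[OF subspace_span, of _ x] SX X by (auto simp: h_def intro!: subspace_diff)
    have horth: "inner \<nu> h = 0" if "\<nu> \<in> ?S" for \<nu>
      using orth_proj_orthogonal[OF subspace_span that, of x] by (simp add: h_def inner_diff_right)
    have \<mu>0: "\<mu> (t *\<^sub>R h) \<le> 0" for t
    proof (rule ccontr)
      assume "\<not> \<mu> (t *\<^sub>R h) \<le> 0"
      define m where "m = \<mu> (t *\<^sub>R h)"
      have m: "m > 0" using \<open>\<not> \<mu> (t *\<^sub>R h) \<le> 0\<close> by (simp add: m_def)
      define q where "q = (1 / m) *\<^sub>R (t *\<^sub>R h)"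
      have "\<mu> q = 1" using minkowski_functional_polar_scale[OF D(1,2), of "1 / m" "t *\<^sub>R h"] m
        by (simp add: q_def m_def \<mu>_def W_def)
      then have q: "q \<in> frontier W" using fr by simp
      obtain \<xi> where \<xi>: "\<xi> \<in> D" "inner \<xi> q = 1" using att[of q] \<open>\<mu> q = 1\<close> by auto
      have "outer_normal W q \<in> ?S" using q by (intro span_base) auto
      then have "inner (\<xi> /\<^sub>R norm \<xi>) h = 0" using horth[of "outer_normal W q"] unfolding grad[OF \<xi> q] by blast
      moreover have "\<xi> \<noteq> 0" using \<xi>(2) by auto
      ultimately show False using \<xi>(2) by (simp add: q_def)
    qed
    have "inner \<xi> h = 0" if "\<xi> \<in> K" for \<xi>
    proof -
      have "inner \<xi> (t *\<^sub>R h) \<le> 0" for t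
        using minkowski_functional_polar_attained(2)[OF D(1,2), of \<xi> "t *\<^sub>R h"] that D(4) \<mu>0[of t]
        by (force simp: \<mu>_def W_def)
      from this[of 1] this[of "-1"] show ?thesis by simp
    qed
    then have "orthogonal h \<xi>" if "\<xi> \<in> K" for \<xi> using that by (simp add: orthogonal_def inner_commute[of h])
    then have "orthogonal h h" using hX spK by (intro orthogonal_to_span[of h K]) auto
    then have "h = 0" by (simp add: orthogonal_def)
    then have "x = orth_proj ?S x" by (simp add: h_def)
    then show "x \<in> ?S" using orth_proj_in[OF subspace_span, of _ x] by metis
  qed
  show ?thesis
  proof (intro exI[of _ W] conjI)
    show "convex_body W" "0 \<in> interior W" using convex_body_polar[OF D(1)] by (auto simp: W_def)
    show "body_of_class_C1 W" unfolding W_def by (rule polar_body_of_class_C1(1)[OF D(1,2)]) (rule uniq)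
  qed (use E\<mu> NW SX XS in blast)+
qed

section \<open>The equivalence\<close>

text \<open>In the extended reals the infimum over the empty set is infinite, so both sides hold for
  empty \<open>E\<close>.\<close>

lemma INF_ereal_pos_iff:
  fixes f :: "'b \<Rightarrow> real"
  shows "0 < (INF y\<in>E. ereal (f y)) \<longleftrightarrow> (\<exists>c>0. \<forall>y\<in>E. c \<le> f y)"
proof
  assume "0 < (INF y\<in>E. ereal (f y))"
  then obtain c where c: "0 < ereal c" "ereal c < (INF y\<in>E. ereal (f y))" using ereal_dense2 by blast
  have "c \<le> f y" if "y \<in> E" for y using less_INF_D[OF c(2) that] by simp
  then show "\<exists>c>0. \<forall>y\<in>E. c \<le> f y" using c(1) by auto
next
  assume "\<exists>c>0. \<forall>y\<in>E. c \<le> f y"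
  then obtain c where c: "c > 0" "\<forall>y\<in>E. c \<le> f y" by blast
  then have "ereal c \<le> (INF y\<in>E. ereal (f y))" by (intro INF_greatest) auto
  then show "0 < (INF y\<in>E. ereal (f y))" using c(1) by (metis ereal_less(2) less_le_trans)
qed

theorem theorem1p16:
  fixes E X :: "(real ^ 'n) set" and N :: "real ^ 'n \<Rightarrow> real ^ 'n"
  assumes "continuous_on E N" and "N ` E \<subseteq> sphere 0 1" and "subspace X"
  shows "(\<exists>W. convex_body W \<and> 0 \<in> interior W \<and> body_of_class_C1 W \<and> E \<subseteq> frontier W \<and>
              (\<forall>x\<in>E. N x = outer_normal W x) \<and>
              X = span (outer_normal W ` frontier W))
    \<longleftrightarrow>
      (\<forall>x\<in>E. \<forall>y\<in>E. inner (N y) (x - y) \<le> 0) \<and>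
      (\<forall>x z :: nat \<Rightarrow> real ^ 'n.
          range x \<subseteq> E \<longrightarrow> range z \<subseteq> E \<longrightarrow> bounded (range (\<lambda>k. orth_proj X (x k))) \<longrightarrow>
          (\<lambda>k. inner (N (z k)) (x k - z k)) \<longlonglongrightarrow> 0 \<longrightarrow>
          (\<lambda>k. norm (N (z k) - N (x k))) \<longlonglongrightarrow> 0) \<and>
      0 < (INF y\<in>E. ereal (inner (N y) y)) \<and>
      (let d = dim X; Y = span (N ` E); l = dim Y in
         Y \<subseteq> X \<and>
         (Y \<noteq> X \<longrightarrow>
           (\<exists>(w :: nat \<Rightarrow> real ^ 'n) (p :: nat \<Rightarrow> real ^ 'n) (\<epsilon> :: real).
              0 < \<epsilon> \<and> \<epsilon> < 1 \<and>
              inj_on w {1..d - l} \<and> independent (w ` {1..d - l}) \<and>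
              (\<forall>j\<in>{1..d - l}. w j \<in> X \<and> (\<forall>y\<in>Y. orthogonal (w j) y) \<and> norm (w j) = 1) \<and>
              (closure E \<union> {0}) \<inter>
                (\<Union>j\<in>{1..d - l}. {x. \<epsilon> * inner (w j) (x - p j) \<ge> norm (orth_proj Y (x - p j))})
                = {})))"
proof -
  have N1: "N ` E \<subseteq> sphere 0 1" and X: "subspace X" by fact+
  define Y where "Y = span (N ` E)"
  show ?thesis
    unfolding INF_ereal_pos_iff Let_def Y_def[symmetric]
  proof (intro iffI conjI)
    assume "\<exists>W. convex_body W \<and> 0 \<in> interior W \<and> body_of_class_C1 W \<and> E \<subseteq> frontier W \<and>
      (\<forall>x\<in>E. N x = outer_normal W x) \<and> X = span (outer_normal W ` frontier W)"
    then obtain W where W: "convex_body W" "0 \<in> interior W" "body_of_class_C1 W" "E \<subseteq> frontier W"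
      and NW: "\<And>x. x \<in> E \<Longrightarrow> N x = outer_normal W x" and XW: "X = span (outer_normal W ` frontier W)"
      by blast
    obtain D g where D: "compact D" "0 \<in> D" "polar D = W"
      and g: "\<And>x. x \<in> frontier W \<Longrightarrow> g x \<in> D" "\<And>x. x \<in> frontier W \<Longrightarrow> inner (g x) x = 1"
      "\<And>x. x \<in> frontier W \<Longrightarrow> outer_normal W x = g x /\<^sub>R norm (g x)"
      by (rule smooth_body_normals[OF W(1-3)]) blast
    have fW: "frontier W \<subseteq> W" using W(1) by (auto simp: convex_body_def frontier_def)
    have g0: "g y \<noteq> 0" if "y \<in> frontier W" for y using g(2)[OF that] by auto
    have nle: "inner (outer_normal W y) x \<le> inner (outer_normal W y) y"
      if "y \<in> frontier W" "x \<in> W" for x y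
    proof -
      have "inner (g y) x \<le> 1" using g(1)[OF that(1)] that(2) D(3) by (auto simp: polar_def)
      then show ?thesis using g(2,3)[OF that(1)] g0[OF that(1)] by (simp add: divide_simps)
    qed
    have npos: "inner (outer_normal W y) y = 1 / norm (g y)" if "y \<in> frontier W" for y
      using g(2,3)[OF that] by (simp add: divide_simps)
    obtain B where B: "B > 0" "\<And>\<xi>. \<xi> \<in> D \<Longrightarrow> norm \<xi> \<le> B"
      using compact_imp_bounded[OF D(1)] bounded_pos by blast
    have nX: "outer_normal W ` frontier W \<subseteq> X" unfolding XW by (rule span_superset)
    show "\<forall>x\<in>E. \<forall>y\<in>E. inner (N y) (x - y) \<le> 0"
    proof (intro ballI)
      fix x y assume "x \<in> E" "y \<in> E"
      then show "inner (N y) (x - y) \<le> 0"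
        using nle[of y x] W(4) fW NW[of y] by (auto simp: inner_diff_right)
    qed
    show "\<forall>x z. range x \<subseteq> E \<longrightarrow> range z \<subseteq> E \<longrightarrow> bounded (range (\<lambda>k. orth_proj X (x k))) \<longrightarrow>
        (\<lambda>k. inner (N (z k)) (x k - z k)) \<longlonglongrightarrow> 0 \<longrightarrow> (\<lambda>k. norm (N (z k) - N (x k))) \<longlonglongrightarrow> 0"
    proof (intro allI impI)
      fix x z :: "nat \<Rightarrow> real ^ 'n"
      assume a: "range x \<subseteq> E" "range z \<subseteq> E" "bounded (range (\<lambda>k. orth_proj X (x k)))"
        "(\<lambda>k. inner (N (z k)) (x k - z k)) \<longlonglongrightarrow> 0"
      have eq: "N (x k) = outer_normal W (x k)" "N (z k) = outer_normal W (z k)" for k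
        using NW[of "x k"] NW[of "z k"] a(1,2) by auto
      have "range x \<subseteq> frontier W" "range z \<subseteq> frontier W" using a(1,2) W(4) by blast+
      then show "(\<lambda>k. norm (N (z k) - N (x k))) \<longlonglongrightarrow> 0"
        using smooth_body_modulus[OF X W(1-3) nX _ _ a(3), of z] a(4) unfolding eq by blast
    qed
    \<comment> \<open>The value at \<open>y\<close> is the reciprocal of \<open>norm (g y)\<close>,
      and \<open>g y\<close> lies in the bounded set \<open>D\<close>.\<close>
    show "\<exists>c>0. \<forall>y\<in>E. c \<le> inner (N y) y"
    proof (intro exI[of _ "1 / B"] conjI ballI)
      fix y assume y: "y \<in> E"
      then have yf: "y \<in> frontier W" using W(4) by blast
      show "1 / B \<le> inner (N y) y"
        unfolding NW[OF y] npos[OF yf]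
        using g0[OF yf] B(1) B(2)[OF g(1)[OF yf]] by (intro divide_left_mono) auto
    qed (use B(1) in simp)
    show YX: "Y \<subseteq> X"
      unfolding Y_def using nX NW W(4) X by (intro span_minimal) auto
    have clE: "closure E \<union> {0} \<subseteq> W"
      using W(1) subsetD[OF interior_subset W(2)] closure_minimal[OF order_trans[OF W(4) fW]]
      by (simp add: convex_body_def)
    \<comment> \<open>All frontier points with their outer normals form the family; the supporting
      half-spaces contain \<open>W\<close>, hence \<open>closure E\<close> and 0.\<close>
    show "Y \<noteq> X \<longrightarrow> (\<exists>(w :: nat \<Rightarrow> real ^ 'n) p \<epsilon>. 0 < \<epsilon> \<and> \<epsilon> < 1 \<and>
        inj_on w {1..dim X - dim Y} \<and> independent (w ` {1..dim X - dim Y}) \<and>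
        (\<forall>j\<in>{1..dim X - dim Y}. w j \<in> X \<and> (\<forall>y\<in>Y. orthogonal (w j) y) \<and> norm (w j) = 1) \<and>
        (closure E \<union> {0}) \<inter> (\<Union>j\<in>{1..dim X - dim Y}.
          {x. \<epsilon> * inner (w j) (x - p j) \<ge> norm (orth_proj Y (x - p j))}) = {})"
    proof (rule impI, rule disjoint_cones[OF XW])
      show "subspace Y" unfolding Y_def by (rule subspace_span)
      show "inner (outer_normal W q) q > 0" if "q \<in> frontier W" for q using npos[OF that] g0[OF that] by simp
      show "Y \<subseteq> X" by (rule YX)
      show "inner (outer_normal W q) x \<le> inner (outer_normal W q) q"
        if "x \<in> closure E \<union> {0}" "q \<in> frontier W" for x q
        using nle[OF that(2)] clE that(1) by blast
    qed
  next
    assume *: "(\<forall>x\<in>E. \<forall>y\<in>E. inner (N y) (x - y) \<le> 0) \<and>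
      (\<forall>x z :: nat \<Rightarrow> real ^ 'n. range x \<subseteq> E \<longrightarrow> range z \<subseteq> E \<longrightarrow> bounded (range (\<lambda>k. orth_proj X (x k))) \<longrightarrow>
        (\<lambda>k. inner (N (z k)) (x k - z k)) \<longlonglongrightarrow> 0 \<longrightarrow> (\<lambda>k. norm (N (z k) - N (x k))) \<longlonglongrightarrow> 0) \<and>
      (\<exists>c>0. \<forall>y\<in>E. c \<le> inner (N y) y) \<and>
      Y \<subseteq> X \<and> (Y \<noteq> X \<longrightarrow> (\<exists>(w :: nat \<Rightarrow> real ^ 'n) p \<epsilon>. 0 < \<epsilon> \<and> \<epsilon> < 1 \<and>
        inj_on w {1..dim X - dim Y} \<and> independent (w ` {1..dim X - dim Y}) \<and>
        (\<forall>j\<in>{1..dim X - dim Y}. w j \<in> X \<and> (\<forall>y\<in>Y. orthogonal (w j) y) \<and> norm (w j) = 1) \<and>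
        (closure E \<union> {0}) \<inter> (\<Union>j\<in>{1..dim X - dim Y}.
          {x. \<epsilon> * inner (w j) (x - p j) \<ge> norm (orth_proj Y (x - p j))}) = {}))"
    note mono = *[THEN conjunct1, rule_format]
      and modulus = *[THEN conjunct2, THEN conjunct1, rule_format]
      and ex_c = *[THEN conjunct2, THEN conjunct2, THEN conjunct1]
      and YX = *[THEN conjunct2, THEN conjunct2, THEN conjunct2, THEN conjunct1]
      and cones = *[THEN conjunct2, THEN conjunct2, THEN conjunct2, THEN conjunct2]
    obtain c where c: "c > 0" "\<And>y. y \<in> E \<Longrightarrow> c \<le> inner (N y) y" using ex_c by blast
    have NX: "N ` E \<subseteq> X" using YX span_superset[of "N ` E"] by (auto simp: Y_def)
    define G where "G = (\<lambda>x. N x /\<^sub>R inner (N x) x)"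
    have pos: "inner (N y) y > 0" if "y \<in> E" for y using c(1) c(2)[OF that] by linarith
    \<comment> \<open>\<open>G\<close> rescales each \<open>N y\<close> by a positive number, so the
      cones, which are stated for \<open>Y\<close>, can be used with the span of the values of
      \<open>G\<close>.\<close>
    have spG: "span (G ` E) = Y"
    proof
      show "span (G ` E) \<subseteq> Y" unfolding Y_def G_def
        by (intro span_minimal subspace_span) (auto intro!: span_scale intro: span_base)
      show "Y \<subseteq> span (G ` E)" unfolding Y_def
      proof (intro span_minimal subspace_span subsetI)
        fix \<nu> assume "\<nu> \<in> N ` E"
        then obtain y where y: "y \<in> E" "\<nu> = N y" by blast
        have "\<nu> = inner (N y) y *\<^sub>R G y" using y(2) pos[OF y(1)] by (simp add: G_def)
        moreover have "inner (N y) y *\<^sub>R G y \<in> span (G ` E)" using y(1) by (intro span_scale span_base) auto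
        ultimately show "\<nu> \<in> span (G ` E)" by simp
      qed
    qed
    have Epol: "E \<subseteq> polar (G ` E)"
      using mono pos by (auto simp: polar_def G_def inner_diff_right field_simps)
    have GX: "G ` E \<subseteq> X" using NX X by (auto simp: G_def subspace_scale)
    obtain F where F: "finite F" "F \<subseteq> X" "span (G ` E \<union> F) = X" "\<And>f x. \<lbrakk>f \<in> F; x \<in> E\<rbrakk> \<Longrightarrow> inner f x \<le> 1 / 2"
    proof (cases "Y = X")
      case True
      then show ?thesis using that[of "{}"] spG by simp
    next
      case False
      then obtain w p \<epsilon> where w: "0 < \<epsilon>"
        "inj_on w {1..dim X - dim Y}" "independent (w ` {1..dim X - dim Y})"
        "\<And>j. j \<in> {1..dim X - dim Y} \<Longrightarrow> w j \<in> X \<and> (\<forall>y\<in>Y. orthogonal (w j) y)"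
        and V: "(closure E \<union> {0}) \<inter> (\<Union>j\<in>{1..dim X - dim Y}.
          {x. \<epsilon> * inner (w j) (x - p j) \<ge> norm (orth_proj Y (x - p j))}) = {}"
        using mp[OF cones False] by blast
      have V': "\<epsilon> * inner (w j) (x - p j) < norm (orth_proj Y (x - p j))"
        if "j \<in> {1..dim X - dim Y}" "x \<in> insert 0 E" for j x
      proof -
        have "x \<in> closure E \<union> {0}" using that(2) closure_subset[of E] by blast
        then have "\<not> \<epsilon> * inner (w j) (x - p j) \<ge> norm (orth_proj Y (x - p j))" using V that(1) by blast
        then show ?thesis by simp
      qed
      show ?thesis
      proof (rule spanning_functionals_of_cones[OF X GX Epol w(1), unfolded spG, OF w(2,3)])
        show "w j \<in> X \<and> (\<forall>y\<in>Y. orthogonal (w j) y)" if "j \<in> {1..dim X - dim Y}" for j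
          by (rule w(4)[OF that])
        show "\<epsilon> * inner (w j) (x - p j) < norm (orth_proj Y (x - p j))"
          if "j \<in> {1..dim X - dim Y}" "x \<in> insert 0 E" for j x
          by (rule V'[OF that])
      qed (rule that)
    qed
    show "\<exists>W. convex_body W \<and> 0 \<in> interior W \<and> body_of_class_C1 W \<and> E \<subseteq> frontier W \<and>
      (\<forall>x\<in>E. N x = outer_normal W x) \<and> X = span (outer_normal W ` frontier W)"
      using smooth_body_exists[OF X NX N1 mono c modulus F(1,2) F(3)[unfolded G_def] F(4)] .
  qed
qed

end
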